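(* (1) Let $V=\mathbb{C}x\oplus\mathbb{C}y\oplus\mathbb{C}d$ for formal symbols $x,y,d$, and let $I$ be the two-sided ideal of the tensor algebra $T(V)$ generated by $[x,y]$, $[d,x]+\frac13 y$ and $[d,y]+\frac12 x\otimes x$. Then $T(V)/I$ is isomorphic to $\mathcal{R}$ as $\mathbb{C}$-algebras. (2) Let $J$ be the left $\mathcal{R}$-submodule of $\mathcal{R}\otimes_{\mathbb{C}}\mathbb{C}$ generated by $\delta\otimes1$. Then $(\mathcal{R}\otimes_{\mathbb{C}}\mathbb{C})/J$ is isomorphic to $\mathcal{M}$ as left $\mathcal{R}$-modules. (3) Let $J'$ be the left $\mathcal{R}$-submodule of $\mathcal{R}\otimes_{\mathbb{C}}\mathbb{C}\Delta$ generated by $\delta\otimes\Delta$. Then $(\mathcal{R}\otimes_{\mathbb{C}}\mathbb{C}\Delta)/J'$ is isomorphic to $\mathcal{S}$ as left $\mathcal{R}$-modules. (4) There is a $\mathbb{C}$-algebra embedding of $\mathcal{R}$ into the Weyl algebra $A_2(\mathbb{C})$ generated by $x,y,\partial/\partial x,\partial/\partial y$.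
   Context: Let $\mathrm{Hol}$ be the space of holomorphic functions on the upper half plane, $q=e^{2\pi iz}$, $f'=\frac{1}{2\pi i}\frac{df}{dz}$, and $E_2,E_4,E_6$ the Eisenstein series with constant term $1$; $\Delta=\frac{1}{1728}(E_4^3-E_6^2)$. For $k\in\mathbb{R}$ let $D_kf=f'-\frac{k}{12}E_2f$. Let $H=\bigoplus_{n\in\mathbb{R}}H_n$ where each $H_n$ is a copy of $\mathrm{Hol}$, elements of $H_n$ being written $(f,n)$; $H$ is a graded commutative $\mathbb{C}$-algebra via $(f,n)(g,m)=(fg,n+m)$. Let $\mathrm{End}(H)=\bigoplus_{i\in\mathbb{R}}\mathrm{End}^i(H)$, where $\mathrm{End}^i(H)$ consists of the $\mathbb{C}$-linear maps sending $H_n$ into $H_{n+i}$ for all $n$. Define $\delta(f,n)=(D_nf,n+2)$, $e_4(f,n)=(E_4f,n+4)$, $e_6(f,n)=(E_6f,n+6)$, and let $\mathcal{R}$ be the $\mathbb{C}$-subalgebra of $\mathrm{End}(H)$ generated by $\delta,e_4,e_6$; $H$ is a left $\mathcal{R}$-module. $\mathcal{M}=\mathbb{C}[E_4,E_6]=\bigoplus_n\mathcal{M}_n$ (holomorphic modular forms of level one, $\mathcal{M}_n$ viewed inside $H_n$) and $\mathcal{S}=\Delta\mathcal{M}$ (cusp forms) are left $\mathcal{R}$-submodules of $H$. In (2), $\mathcal{R}\otimes_{\mathbb{C}}\mathbb{C}$ carries the left $\mathcal{R}$-module structure by left multiplication, with $\mathbb{C}=\mathcal{M}_0$; in (3), $\mathbb{C}\Delta\subset\mathcal{M}_{12}$.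 *)

theory Defs
  imports "HOL-Analysis.Analysis"
begin

text \<open>The tensor algebra T(V) of the vector space V with basis given by the letters
  is realised as the algebra of finitely supported complex-valued functions on words
  (noncommutative polynomials); multiplication is concatenation-convolution.\<close>

type_synonym 'a ncp = "'a list \<Rightarrow> complex"

definition ncT :: "'a ncp set" where
  "ncT = {p. finite {w. p w \<noteq> 0}}"

definition nc_zero :: "'a ncp" where "nc_zero = (\<lambda>w. 0)"
definition nc_one :: "'a ncp" where "nc_one = (\<lambda>w. if w = [] then 1 else 0)"
definition nc_var :: "'a \<Rightarrow> 'a ncp" where "nc_var a = (\<lambda>w. if w = [a] then 1 else 0)"
definition nc_add :: "'a ncp \<Rightarrow> 'a ncp \<Rightarrow> 'a ncp" where "nc_add p q = (\<lambda>w. p w + q w)"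
definition nc_diff :: "'a ncp \<Rightarrow> 'a ncp \<Rightarrow> 'a ncp" where "nc_diff p q = (\<lambda>w. p w - q w)"
definition nc_smult :: "complex \<Rightarrow> 'a ncp \<Rightarrow> 'a ncp" where "nc_smult c p = (\<lambda>w. c * p w)"
definition nc_mult :: "'a ncp \<Rightarrow> 'a ncp \<Rightarrow> 'a ncp" where
  "nc_mult p q = (\<lambda>w. \<Sum>i\<le>length w. p (take i w) * q (drop i w))"
definition nc_comm :: "'a ncp \<Rightarrow> 'a ncp \<Rightarrow> 'a ncp" where
  "nc_comm p q = nc_diff (nc_mult p q) (nc_mult q p)"

inductive_set nc_ideal :: "'a ncp set \<Rightarrow> 'a ncp set" for G :: "'a ncp set" where
  gen: "g \<in> G \<Longrightarrow> g \<in> nc_ideal G"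
| zero: "nc_zero \<in> nc_ideal G"
| add: "p \<in> nc_ideal G \<Longrightarrow> q \<in> nc_ideal G \<Longrightarrow> nc_add p q \<in> nc_ideal G"
| lmult: "a \<in> ncT \<Longrightarrow> p \<in> nc_ideal G \<Longrightarrow> nc_mult a p \<in> nc_ideal G"
| rmult: "a \<in> ncT \<Longrightarrow> p \<in> nc_ideal G \<Longrightarrow> nc_mult p a \<in> nc_ideal G"

datatype gen3 = GX | GY | GD

definition I3 :: "gen3 ncp set" where
  "I3 = nc_ideal
     { nc_comm (nc_var GX) (nc_var GY),
       nc_add (nc_comm (nc_var GD) (nc_var GX)) (nc_smult (1/3) (nc_var GY)),
       nc_add (nc_comm (nc_var GD) (nc_var GY)) (nc_smult (1/2) (nc_mult (nc_var GX) (nc_var GX))) }"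

datatype gen4 = WX | WY | WDX | WDY

definition IWeyl :: "gen4 ncp set" where
  "IWeyl = nc_ideal
     { nc_diff (nc_comm (nc_var WDX) (nc_var WX)) nc_one,
       nc_diff (nc_comm (nc_var WDY) (nc_var WY)) nc_one,
       nc_comm (nc_var WDX) (nc_var WY),
       nc_comm (nc_var WDY) (nc_var WX),
       nc_comm (nc_var WX) (nc_var WY),
       nc_comm (nc_var WDX) (nc_var WDY) }"

definition uhp :: "complex set" where "uhp = {z. 0 < Im z}"

definition qexp :: "complex \<Rightarrow> complex" where
  "qexp z = exp (2 * of_real pi * \<i> * z)"

definition dsigma :: "nat \<Rightarrow> nat \<Rightarrow> nat" where
  "dsigma k n = (\<Sum>d\<in>{d. d dvd n}. d ^ k)"

definition E2 :: "complex \<Rightarrow> complex" where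
  "E2 z = 1 - 24 * (\<Sum>n. of_nat (dsigma 1 (Suc n)) * qexp z ^ Suc n)"
definition E4 :: "complex \<Rightarrow> complex" where
  "E4 z = 1 + 240 * (\<Sum>n. of_nat (dsigma 3 (Suc n)) * qexp z ^ Suc n)"
definition E6 :: "complex \<Rightarrow> complex" where
  "E6 z = 1 - 504 * (\<Sum>n. of_nat (dsigma 5 (Suc n)) * qexp z ^ Suc n)"
definition Delta :: "complex \<Rightarrow> complex" where
  "Delta z = (E4 z ^ 3 - E6 z ^ 2) / 1728"

definition Hol :: "(complex \<Rightarrow> complex) set" where
  "Hol = {f. f holomorphic_on uhp \<and> (\<forall>z. z \<notin> uhp \<longrightarrow> f z = 0)}"

text \<open>An element F of H = direct sum of H_n (n real): F n is its H_n-component.\<close>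
type_synonym hvec = "real \<Rightarrow> complex \<Rightarrow> complex"
type_synonym hop = "hvec \<Rightarrow> hvec"

definition Hspace :: "hvec set" where
  "Hspace = {F. (\<forall>n. F n \<in> Hol) \<and> finite {n. F n \<noteq> (\<lambda>z. 0)}}"

definition hzero :: hvec where "hzero = (\<lambda>n z. 0)"
definition hadd :: "hvec \<Rightarrow> hvec \<Rightarrow> hvec" where "hadd F G = (\<lambda>n z. F n z + G n z)"
definition hsmult :: "complex \<Rightarrow> hvec \<Rightarrow> hvec" where "hsmult c F = (\<lambda>n z. c * F n z)"

definition Dk :: "real \<Rightarrow> (complex \<Rightarrow> complex) \<Rightarrow> complex \<Rightarrow> complex" where
  "Dk k f z = (if z \<in> uhp then deriv f z / (2 * of_real pi * \<i>) - of_real k / 12 * E2 z * f z else 0)"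

text \<open>Operators are extended by 0 outside H, so that equality of operators is equality in End(H).\<close>
definition delta_op :: hop where
  "delta_op F = (if F \<in> Hspace then (\<lambda>m. Dk (m - 2) (F (m - 2))) else hzero)"
definition e4_op :: hop where
  "e4_op F = (if F \<in> Hspace then (\<lambda>m z. E4 z * F (m - 4) z) else hzero)"
definition e6_op :: hop where
  "e6_op F = (if F \<in> Hspace then (\<lambda>m z. E6 z * F (m - 6) z) else hzero)"
definition id_op :: hop where
  "id_op F = (if F \<in> Hspace then F else hzero)"
definition zero_op :: hop where "zero_op = (\<lambda>F. hzero)"
definition op_add :: "hop \<Rightarrow> hop \<Rightarrow> hop" where "op_add A B = (\<lambda>F. hadd (A F) (B F))"
definition op_smult :: "complex \<Rightarrow> hop \<Rightarrow> hop" where "op_smult c A = (\<lambda>F. hsmult c (A F))"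

inductive_set Ralg :: "hop set" where
  delta: "delta_op \<in> Ralg"
| e4: "e4_op \<in> Ralg"
| e6: "e6_op \<in> Ralg"
| one: "id_op \<in> Ralg"
| add: "A \<in> Ralg \<Longrightarrow> B \<in> Ralg \<Longrightarrow> op_add A B \<in> Ralg"
| smult: "A \<in> Ralg \<Longrightarrow> op_smult c A \<in> Ralg"
| comp: "A \<in> Ralg \<Longrightarrow> B \<in> Ralg \<Longrightarrow> A \<circ> B \<in> Ralg"

definition Rdelta :: "hop set" where
  "Rdelta = {r \<circ> delta_op | r. r \<in> Ralg}"

definition Mwt :: "real \<Rightarrow> (complex \<Rightarrow> complex) set" where
  "Mwt n = {(\<lambda>z. if z \<in> uhp then
               (\<Sum>(a,b)\<in>{(a::nat,b::nat). 4 * real a + 6 * real b = n}. c a b * E4 z ^ a * E6 z ^ b)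
             else 0) | c. True}"

definition Mset :: "hvec set" where
  "Mset = {F \<in> Hspace. \<forall>n. F n \<in> Mwt n}"

definition Sset :: "hvec set" where
  "Sset = {F. \<exists>G\<in>Mset. F = (\<lambda>n z. Delta z * G (n - 12) z)}"

definition quot_alg_iso :: "'a ncp set \<Rightarrow> bool" where
  "quot_alg_iso I \<longleftrightarrow> (\<exists>\<phi>. \<phi> ` ncT = Ralg
      \<and> (\<forall>p\<in>ncT. \<forall>q\<in>ncT. \<phi> (nc_add p q) = op_add (\<phi> p) (\<phi> q))
      \<and> (\<forall>c. \<forall>p\<in>ncT. \<phi> (nc_smult c p) = op_smult c (\<phi> p))
      \<and> (\<forall>p\<in>ncT. \<forall>q\<in>ncT. \<phi> (nc_mult p q) = \<phi> p \<circ> \<phi> q)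
      \<and> \<phi> nc_one = id_op
      \<and> (\<forall>p\<in>ncT. \<phi> p = zero_op \<longleftrightarrow> p \<in> I))"

definition quot_mod_iso :: "hop set \<Rightarrow> hvec set \<Rightarrow> bool" where
  "quot_mod_iso J N \<longleftrightarrow> (\<exists>\<phi>. \<phi> ` Ralg = N
      \<and> (\<forall>s\<in>Ralg. \<forall>t\<in>Ralg. \<phi> (op_add s t) = hadd (\<phi> s) (\<phi> t))
      \<and> (\<forall>c. \<forall>s\<in>Ralg. \<phi> (op_smult c s) = hsmult c (\<phi> s))
      \<and> (\<forall>r\<in>Ralg. \<forall>s\<in>Ralg. \<phi> (r \<circ> s) = r (\<phi> s))
      \<and> (\<forall>s\<in>Ralg. \<phi> s = hzero \<longleftrightarrow> s \<in> J))"

text \<open>C-algebra embedding of R into T/I: a map to representatives in T that is a unital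
  algebra homomorphism modulo I and injective modulo I.\<close>
definition alg_embeds_into_quot :: "'a ncp set \<Rightarrow> bool" where
  "alg_embeds_into_quot I \<longleftrightarrow> (\<exists>\<psi>. (\<forall>a\<in>Ralg. \<psi> a \<in> ncT)
      \<and> (\<forall>a\<in>Ralg. \<forall>b\<in>Ralg. nc_diff (\<psi> (op_add a b)) (nc_add (\<psi> a) (\<psi> b)) \<in> I)
      \<and> (\<forall>c. \<forall>a\<in>Ralg. nc_diff (\<psi> (op_smult c a)) (nc_smult c (\<psi> a)) \<in> I)
      \<and> (\<forall>a\<in>Ralg. \<forall>b\<in>Ralg. nc_diff (\<psi> (a \<circ> b)) (nc_mult (\<psi> a) (\<psi> b)) \<in> I)
      \<and> nc_diff (\<psi> id_op) nc_one \<in> I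
      \<and> (\<forall>a\<in>Ralg. \<psi> a \<in> I \<longrightarrow> a = zero_op))"

end

theory Submission
  imports Defs "HOL-Complex_Analysis.Complex_Analysis"
begin

text \<open>Ramanujan's identities \<open>D E4 = - E6 / 3\<close> and \<open>D E6 = - E4\<^sup>2 / 2\<close> say that the generators of the
  operator algebra satisfy the three relations, and that \<open>D Delta = 0\<close>; they reduce to convolution
  identities for divisor sums, which have a combinatorial proof due to Skoruppa.

  By the relations every element of \<open>T(V)/I\<close> is a sum of terms \<open>a(x, y) d\<^sup>k\<close>. Commuting such an element
  of degree \<open>N\<close> in \<open>d\<close> with \<open>x\<close> lowers the degree by one and multiplies the leading coefficient by
  \<open>- N y / 3\<close>. Hence a two-sided ideal that contains no nonzero polynomial in \<open>x\<close>, \<open>y\<close> is zero. This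
  applies to the kernel of the action on \<open>H\<close>, since \<open>E4\<close> and \<open>E6\<close> are algebraically independent, and
  to the kernel of the homomorphism to the Weyl algebra that sends \<open>d\<close> to
  \<open>- y/3 \<partial>/\<partial>x - x\<^sup>2/2 \<partial>/\<partial>y\<close>. For a vector killed by \<open>\<delta>\<close>, such as \<open>1\<close> or \<open>Delta\<close>, only the
  term with \<open>k = 0\<close> acts on it, and independence identifies its annihilator with \<open>R \<delta>\<close>.\<close>

section \<open>Convolution sums of divisor functions\<close>


text \<open>The differential equations are identities of formal power series in \<open>q\<close> and
  are proved coefficient by coefficient. The test functions in Skoruppa's identity are even
  symmetric forms in \<open>a, b, - a - b\<close>: up to scalars there is one of degree 4, but a
  two-dimensional space of them in degree 6. The cube of the quadratic form brings in the
  convolution of \<open>\<sigma>\<^sub>3\<close> with itself, which the square of the cubic form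
  isolates; this is why the equation for \<open>E6\<close> depends on
  \<open>E4\<^sup>2 = E8\<close>. The normal form \<open>a(x, y) d\<^sup>k\<close> comes without
  uniqueness, since \<open>T(V)/I\<close> is known only through its relations, and a factor
  \<open>y\<close> cannot be cancelled inside it. The powers of \<open>y\<close> produced by the
  commutators are therefore carried along until a concrete module is reached, where they merely
  shift an exponent. The module \<open>H\<close> also settles linear combinations of mixed weight:
  its grading splits a polynomial into homogeneous parts, so independence of \<open>E4\<close> and
  \<open>E6\<close> is only required in one weight at a time.\<close>

definition quads :: "nat \<Rightarrow> (nat \<times> nat \<times> nat \<times> nat) set" where
  "quads n = {(a, b, x, y). 0 < a \<and> 0 < b \<and> 0 < x \<and> 0 < y \<and> a * x + b * y = n}"

lemma finite_quads [simp]: "finite (quads n)"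
proof (rule finite_subset)
  show "quads n \<subseteq> {..n} \<times> {..n} \<times> {..n} \<times> {..n}"
  proof safe
    fix a b x y assume "(a, b, x, y) \<in> quads n"
    then have *: "0 < a" "0 < b" "0 < x" "0 < y" "a * x + b * y = n" by (auto simp: quads_def)
    have "a * 1 \<le> a * x" "1 * x \<le> a * x" "b * 1 \<le> b * y" "1 * y \<le> b * y"
      by (rule mult_le_mono; use * in simp)+
    then have "a \<le> a * x \<and> x \<le> a * x \<and> b \<le> b * y \<and> y \<le> b * y" by simp
    with *(5) show "a \<le> n" "b \<le> n" "x \<le> n" "y \<le> n" by linarith+
  qed
qed auto

lemma sum_quads_split:
  fixes f :: "nat \<times> nat \<times> nat \<times> nat \<Rightarrow> int"
  shows "sum f (quads n) = sum f {(a, b, x, y) \<in> quads n. u a b x y < (v a b x y :: nat)}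
     + sum f {(a, b, x, y) \<in> quads n. v a b x y < u a b x y}
     + sum f {(a, b, x, y) \<in> quads n. u a b x y = v a b x y}"
proof -
  let ?A = "{(a, b, x, y) \<in> quads n. u a b x y < v a b x y}"
  let ?B = "{(a, b, x, y) \<in> quads n. v a b x y < u a b x y}"
  let ?C = "{(a, b, x, y) \<in> quads n. u a b x y = v a b x y}"
  have fin: "finite ?A" "finite ?B" "finite ?C"
    by (rule finite_subset[OF _ finite_quads[of n]]; auto)+
  have eq: "quads n = (?A \<union> ?B) \<union> ?C" by auto
  have "sum f (quads n) = sum f (?A \<union> ?B) + sum f ?C"
    by (subst eq, rule sum.union_disjoint) (use fin in auto)
  also have "sum f (?A \<union> ?B) = sum f ?A + sum f ?B"
    by (rule sum.union_disjoint) (use fin in auto)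
  finally show ?thesis by simp
qed

text \<open>Skoruppa's identity. An even function \<open>h\<close> of the triple \<open>(a, b, - a - b)\<close>, symmetric in its
  three entries, satisfies \<open>h a (- b) = h a (b - a)\<close>, and \<open>a x + b y = a (x + y) + (b - a) y\<close>;
  so the terms of the second sum with \<open>a \<noteq> b\<close> cancel those of the first sum with \<open>x \<noteq> y\<close>.\<close>

lemma skoruppa:
  fixes h :: "int \<Rightarrow> int \<Rightarrow> int"
  assumes sym: "\<And>a b. h a b = h b a" and even: "\<And>a b. h (- a) (- b) = h a b"
    and inv: "\<And>a b. h a (- b) = h a (b - a)" and n: "0 < n"
  shows "(\<Sum>(a, b, x, y) \<in> quads n. h (int a) (int b) - h (int a) (- int b))
       = (\<Sum>d | d dvd n. (\<Sum>a = 1..<d. h (int a) (int d - int a)) - (int (n div d) - 1) * h (int d) 0)"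
proof -
  let ?f = "\<lambda>(a, b, x::nat, y::nat). h (int a) (int b)"
  let ?g = "\<lambda>(a, b, x::nat, y::nat). h (int a) (- int b)"
  have findvd: "finite {d. d dvd n}" using n by auto
  have dpos: "0 < d" if "d dvd n" for d using that n by (simp add: dvd_pos_nat)
  have 1: "sum ?g {(a, b, x, y) \<in> quads n. a < b} = sum ?f {(a, b, x, y) \<in> quads n. y < x}"
  proof (rule sum.reindex_bij_witness[where i = "\<lambda>(a, b, x, y). (a, a + b, x - y, y)"
        and j = "\<lambda>(a, b, x, y). (a, b - a, x + y, y)"]; clarsimp)
    fix a b x y assume "(a, b, x, y) \<in> quads n" "a < b"
    moreover from \<open>a < b\<close> obtain k where "b = a + k" by (metis less_imp_add_positive)
    ultimately show "(a, b - a, x + y, y) \<in> quads n \<and> 0 < x"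
      by (auto simp: quads_def algebra_simps)
  next
    fix a b x y assume "(a, b, x, y) \<in> quads n" "y < x"
    moreover from \<open>y < x\<close> obtain k where "x = y + k" by (metis less_imp_add_positive)
    ultimately show "(a, a + b, x - y, y) \<in> quads n \<and> 0 < b"
      by (auto simp: quads_def algebra_simps)
  next
    fix a b x y assume "(a, b, x, y) \<in> quads n" "(a::nat) < b"
    then show "h (int a) (int b - int a) = h (int a) (- int b)"
      using inv[of "int a" "int b"] by (simp add: of_nat_diff)
  qed
  have 2: "sum ?g {(a, b, x, y) \<in> quads n. b < a} = sum ?f {(a, b, x, y) \<in> quads n. x < y}"
  proof (rule sum.reindex_bij_witness[where i = "\<lambda>(a, b, x, y). (a + b, b, x, y - x)"
        and j = "\<lambda>(a, b, x, y). (a - b, b, x, x + y)"]; clarsimp)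
    fix a b x y assume "(a, b, x, y) \<in> quads n" "b < a"
    moreover from \<open>b < a\<close> obtain k where "a = b + k" by (metis less_imp_add_positive)
    ultimately show "(a - b, b, x, x + y) \<in> quads n \<and> 0 < y"
      by (auto simp: quads_def algebra_simps)
  next
    fix a b x y assume "(a, b, x, y) \<in> quads n" "x < y"
    moreover from \<open>x < y\<close> obtain k where "y = x + k" by (metis less_imp_add_positive)
    ultimately show "(a + b, b, x, y - x) \<in> quads n \<and> 0 < a"
      by (auto simp: quads_def algebra_simps)
  next
    fix a b x y assume "(a, b, x, y) \<in> quads n" "(b::nat) < a"
    \<comment> \<open>Evenness and symmetry give \<open>h a (- b) = h b (- a)\<close>, to which
      \<open>inv\<close> applies with the roles of \<open>a\<close> and \<open>b\<close>
      exchanged.\<close>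
    then show "h (int a - int b) (int b) = h (int a) (- int b)"
      using inv[of "int b" "int a"] sym even[of "int b" "- int a"] by (simp add: of_nat_diff)
  qed
  \<comment> \<open>On \<open>a = b\<close> the value \<open>h a (- a)\<close> equals
    \<open>h a 0\<close> by \<open>inv\<close>, and \<open>x + y = n div a\<close> has
    \<open>n div a - 1\<close> solutions in positive numbers.\<close>
  have 3: "sum ?g {(a, b, x, y) \<in> quads n. a = b} = (\<Sum>d | d dvd n. (int (n div d) - 1) * h (int d) 0)"
  proof -
    have "sum ?g {(a, b, x, y) \<in> quads n. a = b}
        = (\<Sum>(d, x) \<in> Sigma {d. d dvd n} (\<lambda>d. {1..<n div d}). h (int d) 0)"
    proof (rule sum.reindex_bij_witness[where i = "\<lambda>(d, x). (d, d, x, n div d - x)"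
        and j = "\<lambda>(a, b, x, y). (a, x)"]; clarsimp)
      fix a x y assume "(a, a, x, y) \<in> quads n"
      then have *: "0 < a" "0 < x" "0 < y" "n = a * (x + y)" by (auto simp: quads_def algebra_simps)
      then show "n div a - x = y" "a dvd n \<and> Suc 0 \<le> x \<and> x < n div a" by auto
    next
      fix a x assume "a dvd n" "Suc 0 \<le> x" "x < n div a"
      then show "(a, a, x, n div a - x) \<in> quads n"
        using dpos[of a] by (auto simp: quads_def diff_mult_distrib2)
    next
      fix a show "h (int a) 0 = h (int a) (- int a)" using inv[of "int a" "int a"] by simp
    qed
    also have "\<dots> = (\<Sum>d | d dvd n. \<Sum>x = 1..<n div d. h (int d) 0)"
      using findvd by (subst sum.Sigma) auto
    also have "\<dots> = (\<Sum>d | d dvd n. (int (n div d) - 1) * h (int d) 0)"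
    proof (rule sum.cong)
      fix d assume "d \<in> {d. d dvd n}"
      then have "1 \<le> n div d" using dpos[of d] n by (auto simp: div_greater_zero_iff Suc_le_eq dest: dvd_imp_le)
      then show "(\<Sum>x = 1..<n div d. h (int d) 0) = (int (n div d) - 1) * h (int d) 0"
        by (simp add: of_nat_diff)
    qed simp
    finally show ?thesis .
  qed
  \<comment> \<open>On \<open>x = y\<close> the sum \<open>d = a + b\<close> is a divisor of
    \<open>n\<close> with codivisor \<open>x\<close>, and \<open>a\<close> runs freely below
    \<open>d\<close>.\<close>
  have 4: "sum ?f {(a, b, x, y) \<in> quads n. x = y}
      = (\<Sum>d | d dvd n. \<Sum>a = 1..<d. h (int a) (int d - int a))"
  proof -
    have "sum ?f {(a, b, x, y) \<in> quads n. x = y}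
        = (\<Sum>(d, a) \<in> Sigma {d. d dvd n} (\<lambda>d. {1..<d}). h (int a) (int d - int a))"
    proof (rule sum.reindex_bij_witness[where i = "\<lambda>(d, a). (a, d - a, n div d, n div d)"
        and j = "\<lambda>(a, b, x, y). (a + b, a)"]; clarsimp)
      fix a b y assume "(a, b, y, y) \<in> quads n"
      then have *: "0 < a" "0 < b" "0 < y" "n = (a + b) * y" by (auto simp: quads_def algebra_simps)
      then show "n div (a + b) = y" "a + b dvd n \<and> Suc 0 \<le> a \<and> 0 < b" by auto
    next
      fix d a assume *: "d dvd n" "Suc 0 \<le> a" "a < d"
      then have "0 < n div d" using n dpos[of d] by (auto simp: div_greater_zero_iff dest: dvd_imp_le)
      moreover have "a * (n div d) + (d - a) * (n div d) = d * (n div d)"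
        using * by (metis add_mult_distrib le_add_diff_inverse less_imp_le)
      ultimately show "(a, d - a, n div d, n div d) \<in> quads n"
        using * by (auto simp: quads_def)
    qed
    also have "\<dots> = (\<Sum>d | d dvd n. \<Sum>a = 1..<d. h (int a) (int d - int a))"
      using findvd by (subst sum.Sigma) auto
    finally show ?thesis .
  qed
  have "(\<Sum>(a, b, x, y) \<in> quads n. h (int a) (int b) - h (int a) (- int b)) = sum ?f (quads n) - sum ?g (quads n)"
    unfolding sum_subtractf[symmetric] by (rule sum.cong) auto
  also have "sum ?f (quads n) = sum ?f {(a, b, x, y) \<in> quads n. x < y} + sum ?f {(a, b, x, y) \<in> quads n. y < x}
      + sum ?f {(a, b, x, y) \<in> quads n. x = y}"
    by (rule sum_quads_split)
  also have "sum ?g (quads n) = sum ?g {(a, b, x, y) \<in> quads n. a < b} + sum ?g {(a, b, x, y) \<in> quads n. b < a}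
      + sum ?g {(a, b, x, y) \<in> quads n. a = b}"
    by (rule sum_quads_split)
  finally show ?thesis unfolding 1 2 3 4 sum_subtractf by linarith
qed

text \<open>With \<open>m = a * x\<close>, the remaining term \<open>b * y\<close> is
  \<open>n - m\<close>: a quadruple is a choice of \<open>m\<close> together with a divisor of each
  part.\<close>

lemma sum_quads_dsigma:
  "(\<Sum>(a, b, x, y) \<in> quads n. int a ^ i * int b ^ j)
    = (\<Sum>m = 1..<n. int (dsigma i m) * int (dsigma j (n - m)))"
proof -
  have findvd: "finite {d. d dvd m}" if "0 < m" for m :: nat using that by auto
  have "(\<Sum>m = 1..<n. int (dsigma i m) * int (dsigma j (n - m)))
      = (\<Sum>m = 1..<n. \<Sum>(a, b) \<in> {a. a dvd m} \<times> {b. b dvd n - m}. int a ^ i * int b ^ j)"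
    unfolding dsigma_def of_nat_sum sum_product sum.cartesian_product by simp
  also have "\<dots> = (\<Sum>(m, a, b) \<in> Sigma {1..<n} (\<lambda>m. {a. a dvd m} \<times> {b. b dvd n - m}). int a ^ i * int b ^ j)"
    by (subst sum.Sigma) (use findvd in \<open>auto intro!: finite_cartesian_product\<close>)
  also have "\<dots> = (\<Sum>(a, b, x, y) \<in> quads n. int a ^ i * int b ^ j)"
  proof (rule sum.reindex_bij_witness[where j = "\<lambda>(m, a, b). (a, b, m div a, (n - m) div b)"
        and i = "\<lambda>(a, b, x, y). (a * x, a, b)"]; clarsimp)
    fix m a b assume *: "Suc 0 \<le> m" "m < n" "a dvd m" "b dvd n - m"
    then have "0 < a" "0 < b" using dvd_pos_nat[of m a] dvd_pos_nat[of "n - m" b] by auto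
    then show "(a, b, m div a, (n - m) div b) \<in> quads n"
      using * by (auto simp: quads_def div_greater_zero_iff dest: dvd_imp_le)
  next
    fix a b x y assume "(a, b, x, y) \<in> quads n"
    then have *: "0 < a" "0 < b" "0 < x" "0 < y" "n = a * x + b * y" by (auto simp: quads_def)
    then show "(a = 0 \<longrightarrow> x = 0 \<and> n div b = y) \<and> (0 < a \<longrightarrow> (n - a * x) div b = y)"
      "Suc 0 \<le> a \<and> Suc 0 \<le> x \<and> a * x < n \<and> b dvd n - a * x" by auto
  qed
  finally show ?thesis by simp
qed

section \<open>Explicit convolution identities for divisor sums\<close>

definition sigma_conv :: "nat \<Rightarrow> nat \<Rightarrow> nat \<Rightarrow> int" where
  "sigma_conv i j n = (\<Sum>m = 1..<n. int (dsigma i m) * int (dsigma j (n - m)))"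

lemma sigma_conv_commute: "sigma_conv i j n = sigma_conv j i n"
  unfolding sigma_conv_def
  by (rule sum.reindex_bij_witness[where i = "\<lambda>m. n - m" and j = "\<lambda>m. n - m"]) auto

lemma sum_lessThan_eq_atLeast1:
  fixes f :: "nat \<Rightarrow> int"
  assumes "0 < d"
  shows "sum f {1..<d} = sum f {..<d} - f 0"
proof -
  have "{..<d} = insert 0 {1..<d}" using assms by auto
  then show ?thesis by simp
qed

text \<open>Only the case \<open>m = d\<close>, \<open>t = int d\<close> is of interest, but the
  induction on the number of terms requires \<open>t\<close> to stay fixed while \<open>m\<close>
  grows. The factor 30 clears the denominators of the power-sum polynomials; the next two lemmas
  follow the same pattern.\<close>

lemma sum_form_pow2:
  "30 * (\<Sum>a<m. (int a ^ 2 - int a * t + t ^ 2) ^ 2)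
   = - int m + 15 * int m * t ^ 2 + 30 * int m * t ^ 3 + 30 * int m * t ^ 4 - 15 * int m ^ 2 * t
     - 45 * int m ^ 2 * t ^ 2 - 30 * int m ^ 2 * t ^ 3 + 10 * int m ^ 3 + 30 * int m ^ 3 * t
     + 30 * int m ^ 3 * t ^ 2 - 15 * int m ^ 4 - 15 * int m ^ 4 * t + 6 * int m ^ 5"
  by (induction m) (simp_all add: algebra_simps eval_nat_numeral)

lemma sum_form_pow3:
  "420 * (\<Sum>a<m. (int a ^ 2 - int a * t + t ^ 2) ^ 3)
   = 10 * int m - 84 * int m * t ^ 2 + 420 * int m * t ^ 4 + 630 * int m * t ^ 5 + 420 * int m * t ^ 6
     + 105 * int m ^ 2 * t - 735 * int m ^ 2 * t ^ 3 - 1260 * int m ^ 2 * t ^ 4 - 630 * int m ^ 2 * t ^ 5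
     - 70 * int m ^ 3 + 840 * int m ^ 3 * t ^ 2 + 1470 * int m ^ 3 * t ^ 3 + 840 * int m ^ 3 * t ^ 4
     - 525 * int m ^ 4 * t - 1260 * int m ^ 4 * t ^ 2 - 735 * int m ^ 4 * t ^ 3 + 210 * int m ^ 5
     + 630 * int m ^ 5 * t + 504 * int m ^ 5 * t ^ 2 - 210 * int m ^ 6 - 210 * int m ^ 6 * t + 60 * int m ^ 7"
  by (induction m) (simp_all add: algebra_simps eval_nat_numeral)

lemma sum_form_disc:
  "30 * (\<Sum>a<m. (int a * (t - int a) * t) ^ 2)
   = - int m * t ^ 2 + 5 * int m * t ^ 4 - 15 * int m ^ 2 * t ^ 3 - 15 * int m ^ 2 * t ^ 4
     + 10 * int m ^ 3 * t ^ 2 + 30 * int m ^ 3 * t ^ 3 + 10 * int m ^ 3 * t ^ 4 - 15 * int m ^ 4 * t ^ 2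
     - 15 * int m ^ 4 * t ^ 3 + 6 * int m ^ 5 * t ^ 2"
  by (induction m) (simp_all add: algebra_simps eval_nat_numeral)

text \<open>The codivisors in Skoruppa's identity thus turn into a factor \<open>n\<close>, the
  trace of the derivative in Ramanujan's equations.\<close>

lemma sum_divisors_codivisor_power:
  assumes "0 < n"
  shows "(\<Sum>d | d dvd n. int (n div d) * int d ^ Suc k) = int n * int (dsigma k n)"
proof -
  have "int (n div d) * int d ^ Suc k = int n * int d ^ k" if "d dvd n" for d
    using that by (metis dvd_div_mult_self mult.assoc of_nat_mult power_Suc)
  then show ?thesis unfolding dsigma_def of_nat_sum sum_distrib_left of_nat_power by (intro sum.cong) auto
qed

lemma sum_divisors_power: "(\<Sum>d | d dvd n. int d ^ k) = int (dsigma k n)"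
  by (simp add: dsigma_def)

text \<open>For the square of \<open>a b (a + b)\<close> the difference
  \<open>h a b - h a (- b)\<close> is \<open>4 a\<^sup>3 b\<^sup>3\<close>. Since
  \<open>h d 0 = 0\<close>, the codivisors drop out and the result has no derivative term.\<close>

lemma sigma_conv_3_3:
  assumes "0 < n"
  shows "120 * sigma_conv 3 3 n = int (dsigma 7 n) - int (dsigma 3 n)"
proof -
  define h :: "int \<Rightarrow> int \<Rightarrow> int" where "h = (\<lambda>a b. (a * b * (a + b)) ^ 2)"
  have dpos: "0 < d" if "d dvd n" for d using that assms by (simp add: dvd_pos_nat)
  have "4 * sigma_conv 3 3 n = (\<Sum>(a, b, x, y) \<in> quads n. h (int a) (int b) - h (int a) (- int b))"
    unfolding sigma_conv_def sum_quads_dsigma[symmetric] sum_distrib_left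
    by (rule sum.cong) (auto simp: h_def algebra_simps eval_nat_numeral)
  also have "\<dots> = (\<Sum>d | d dvd n. (\<Sum>a = 1..<d. h (int a) (int d - int a)) - (int (n div d) - 1) * h (int d) 0)"
    by (rule skoruppa[OF _ _ _ assms]) (simp_all add: h_def algebra_simps power2_eq_square)
  finally have "30 * (4 * sigma_conv 3 3 n) = 30 * (\<Sum>d | d dvd n. (\<Sum>a = 1..<d. h (int a) (int d - int a)) - (int (n div d) - 1) * h (int d) 0)"
    by (rule arg_cong)
  then have "120 * sigma_conv 3 3 n = 30 * (\<Sum>d | d dvd n. (\<Sum>a = 1..<d. h (int a) (int d - int a)) - (int (n div d) - 1) * h (int d) 0)"
    by (simp only: mult.assoc[symmetric] numeral_times_numeral mult_num_simps)
  also have "\<dots> = (\<Sum>d | d dvd n. 30 * ((\<Sum>a = 1..<d. h (int a) (int d - int a)) - (int (n div d) - 1) * h (int d) 0))"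
    by (rule sum_distrib_left)
  also have "\<dots> = (\<Sum>d | d dvd n. int d ^ 7 - int d ^ 3)"
  proof (rule sum.cong)
    fix d assume "d \<in> {d. d dvd n}"
    then have d: "0 < d" using dpos by auto
    have "(\<Sum>a = 1..<d. h (int a) (int d - int a)) = (\<Sum>a<d. (int a * (int d - int a) * int d) ^ 2)"
      unfolding sum_lessThan_eq_atLeast1[OF d] by (simp add: h_def)
    then have "30 * (\<Sum>a = 1..<d. h (int a) (int d - int a)) = 30 * (\<Sum>a<d. (int a * (int d - int a) * int d) ^ 2)"
      by (rule arg_cong)
    also have "\<dots> = int d ^ 7 - int d ^ 3"
      unfolding sum_form_disc by (simp add: algebra_simps eval_nat_numeral)
    finally have "30 * (\<Sum>a = 1..<d. h (int a) (int d - int a)) = int d ^ 7 - int d ^ 3" .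
    then show "30 * ((\<Sum>a = 1..<d. h (int a) (int d - int a)) - (int (n div d) - 1) * h (int d) 0) = int d ^ 7 - int d ^ 3"
      by (simp add: h_def)
  qed simp
  finally show ?thesis by (simp add: sum_subtractf sum_divisors_power)
qed

text \<open>Here \<open>h a b - h a (- b)\<close> is \<open>4 a\<^sup>3 b + 4 a b\<^sup>3\<close>,
  while \<open>h d 0 = d\<^sup>4\<close> supplies the term \<open>n * dsigma 3 n\<close>.\<close>

lemma sigma_conv_3_1:
  assumes "0 < n"
  shows "240 * sigma_conv 3 1 n
    = 21 * int (dsigma 5 n) + 10 * int (dsigma 3 n) - int (dsigma 1 n) - 30 * int n * int (dsigma 3 n)"
proof -
  define h :: "int \<Rightarrow> int \<Rightarrow> int" where "h = (\<lambda>a b. (a ^ 2 + a * b + b ^ 2) ^ 2)"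
  have dpos: "0 < d" if "d dvd n" for d using that assms by (simp add: dvd_pos_nat)
  have "8 * sigma_conv 3 1 n = 4 * sigma_conv 3 1 n + 4 * sigma_conv 1 3 n"
    using sigma_conv_commute[of 3 1 n] by simp
  also have "\<dots> = (\<Sum>(a, b, x, y) \<in> quads n. h (int a) (int b) - h (int a) (- int b))"
    unfolding sigma_conv_def sum_quads_dsigma[symmetric] sum_distrib_left sum.distrib[symmetric]
    by (rule sum.cong) (auto simp: h_def algebra_simps eval_nat_numeral)
  also have "\<dots> = (\<Sum>d | d dvd n. (\<Sum>a = 1..<d. h (int a) (int d - int a)) - (int (n div d) - 1) * h (int d) 0)"
    by (rule skoruppa[OF _ _ _ assms]) (simp_all add: h_def algebra_simps eval_nat_numeral)
  finally have "30 * (8 * sigma_conv 3 1 n) = 30 * (\<Sum>d | d dvd n. (\<Sum>a = 1..<d. h (int a) (int d - int a)) - (int (n div d) - 1) * h (int d) 0)"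
    by (rule arg_cong)
  then have "240 * sigma_conv 3 1 n = 30 * (\<Sum>d | d dvd n. (\<Sum>a = 1..<d. h (int a) (int d - int a)) - (int (n div d) - 1) * h (int d) 0)"
    by (simp only: mult.assoc[symmetric] numeral_times_numeral mult_num_simps)
  also have "\<dots> = (\<Sum>d | d dvd n. 30 * ((\<Sum>a = 1..<d. h (int a) (int d - int a)) - (int (n div d) - 1) * h (int d) 0))"
    by (rule sum_distrib_left)
  also have "\<dots> = (\<Sum>d | d dvd n. 21 * int d ^ 5 + 10 * int d ^ 3 - int d ^ 1 - 30 * (int (n div d) * int d ^ Suc 3))"
  proof (rule sum.cong)
    fix d assume "d \<in> {d. d dvd n}"
    then have d: "0 < d" using dpos by auto
    have "h (int a) (int d - int a) = (int a ^ 2 - int a * int d + int d ^ 2) ^ 2" for a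
      by (simp add: h_def algebra_simps eval_nat_numeral)
    moreover have "h 0 (int d) = int d ^ 4" by (simp add: h_def)
    ultimately have "30 * (\<Sum>a = 1..<d. h (int a) (int d - int a))
        = 30 * (\<Sum>a<d. (int a ^ 2 - int a * int d + int d ^ 2) ^ 2) - 30 * int d ^ 4"
      unfolding sum_lessThan_eq_atLeast1[OF d] by (simp add: algebra_simps)
    also have "\<dots> = 21 * int d ^ 5 - 30 * int d ^ 4 + 10 * int d ^ 3 - int d"
      unfolding sum_form_pow2 by (simp add: algebra_simps eval_nat_numeral)
    finally have "30 * (\<Sum>a = 1..<d. h (int a) (int d - int a)) = 21 * int d ^ 5 - 30 * int d ^ 4 + 10 * int d ^ 3 - int d" .
    then show "30 * ((\<Sum>a = 1..<d. h (int a) (int d - int a)) - (int (n div d) - 1) * h (int d) 0)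
        = 21 * int d ^ 5 + 10 * int d ^ 3 - int d ^ 1 - 30 * (int (n div d) * int d ^ Suc 3)"
      by (simp add: h_def algebra_simps flip: power_mult)
  qed simp
  finally show ?thesis
    unfolding sum_subtractf sum.distrib sum_distrib_left[symmetric] sum_divisors_power
      sum_divisors_codivisor_power[OF assms] by simp
qed

text \<open>Here \<open>h a b - h a (- b)\<close> is
  \<open>6 a\<^sup>5 b + 6 a b\<^sup>5 + 14 a\<^sup>3 b\<^sup>3\<close>; the last term is removed by
  \<open>sigma_conv_3_3\<close>.\<close>

lemma sigma_conv_5_1:
  assumes "0 < n"
  shows "504 * sigma_conv 5 1 n
    = 20 * int (dsigma 7 n) + 21 * int (dsigma 5 n) + int (dsigma 1 n) - 42 * int n * int (dsigma 5 n)"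
proof -
  define h :: "int \<Rightarrow> int \<Rightarrow> int" where "h = (\<lambda>a b. (a ^ 2 + a * b + b ^ 2) ^ 3)"
  have dpos: "0 < d" if "d dvd n" for d using that assms by (simp add: dvd_pos_nat)
  have "12 * sigma_conv 5 1 n + 14 * sigma_conv 3 3 n = 6 * sigma_conv 5 1 n + 6 * sigma_conv 1 5 n + 14 * sigma_conv 3 3 n"
    using sigma_conv_commute[of 5 1 n] by simp
  also have "\<dots> = (\<Sum>(a, b, x, y) \<in> quads n. h (int a) (int b) - h (int a) (- int b))"
    unfolding sigma_conv_def sum_quads_dsigma[symmetric] sum_distrib_left sum.distrib[symmetric]
    by (rule sum.cong) (auto simp: h_def algebra_simps eval_nat_numeral)
  also have "\<dots> = (\<Sum>d | d dvd n. (\<Sum>a = 1..<d. h (int a) (int d - int a)) - (int (n div d) - 1) * h (int d) 0)"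
    by (rule skoruppa[OF _ _ _ assms]) (simp_all add: h_def algebra_simps eval_nat_numeral)
  finally have "420 * (12 * sigma_conv 5 1 n + 14 * sigma_conv 3 3 n) = 420 * (\<Sum>d | d dvd n. (\<Sum>a = 1..<d. h (int a) (int d - int a)) - (int (n div d) - 1) * h (int d) 0)"
    by (rule arg_cong)
  then have "420 * (12 * sigma_conv 5 1 n + 14 * sigma_conv 3 3 n) = 420 * (\<Sum>d | d dvd n. (\<Sum>a = 1..<d. h (int a) (int d - int a)) - (int (n div d) - 1) * h (int d) 0)"
    by (simp only: mult.assoc[symmetric] numeral_times_numeral mult_num_simps)
  also have "\<dots> = (\<Sum>d | d dvd n. 420 * ((\<Sum>a = 1..<d. h (int a) (int d - int a)) - (int (n div d) - 1) * h (int d) 0))"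
    by (rule sum_distrib_left)
  also have "\<dots> = (\<Sum>d | d dvd n. 249 * int d ^ 7 + 210 * int d ^ 5 - 49 * int d ^ 3 + 10 * int d ^ 1 - 420 * (int (n div d) * int d ^ Suc 5))"
  proof (rule sum.cong)
    fix d assume "d \<in> {d. d dvd n}"
    then have d: "0 < d" using dpos by auto
    have "h (int a) (int d - int a) = (int a ^ 2 - int a * int d + int d ^ 2) ^ 3" for a
      by (simp add: h_def algebra_simps eval_nat_numeral)
    moreover have "h 0 (int d) = int d ^ 6" by (simp add: h_def)
    ultimately have "420 * (\<Sum>a = 1..<d. h (int a) (int d - int a))
        = 420 * (\<Sum>a<d. (int a ^ 2 - int a * int d + int d ^ 2) ^ 3) - 420 * int d ^ 6"
      unfolding sum_lessThan_eq_atLeast1[OF d] by (simp add: algebra_simps)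
    also have "\<dots> = 249 * int d ^ 7 - 420 * int d ^ 6 + 210 * int d ^ 5 - 49 * int d ^ 3 + 10 * int d"
      unfolding sum_form_pow3 by (simp add: algebra_simps eval_nat_numeral)
    finally have "420 * (\<Sum>a = 1..<d. h (int a) (int d - int a)) = 249 * int d ^ 7 - 420 * int d ^ 6 + 210 * int d ^ 5 - 49 * int d ^ 3 + 10 * int d" .
    then show "420 * ((\<Sum>a = 1..<d. h (int a) (int d - int a)) - (int (n div d) - 1) * h (int d) 0)
        = 249 * int d ^ 7 + 210 * int d ^ 5 - 49 * int d ^ 3 + 10 * int d ^ 1 - 420 * (int (n div d) * int d ^ Suc 5)"
      by (simp add: h_def algebra_simps flip: power_mult)
  qed simp
  finally have "420 * (12 * sigma_conv 5 1 n + 14 * sigma_conv 3 3 n)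
      = 249 * int (dsigma 7 n) + 210 * int (dsigma 5 n) - 49 * int (dsigma 3 n) + 10 * int (dsigma 1 n)
        - 420 * (int n * int (dsigma 5 n))"
    unfolding sum_subtractf sum.distrib sum_distrib_left[symmetric] sum_divisors_power
      sum_divisors_codivisor_power[OF assms] by simp
  \<comment> \<open>Since \<open>420 * 14 = 49 * 120\<close>, that identity enters 49 times. It also
    cancels \<open>dsigma 3 n\<close>, and the rest is divisible by 10.\<close>
  with sigma_conv_3_3[OF assms] show ?thesis by simp
qed

section \<open>Ramanujan's differential equations\<close>


text \<open>The pairs \<open>(- 24, 1)\<close>, \<open>(240, 3)\<close>, \<open>(- 504, 5)\<close>
  and \<open>(480, 7)\<close> give the q-expansions of \<open>E2\<close>, \<open>E4\<close>,
  \<open>E6\<close> and of the Eisenstein series of weight 8.\<close>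

definition eis_fps :: "complex \<Rightarrow> nat \<Rightarrow> complex fps" where
  "eis_fps c k = Abs_fps (\<lambda>n. if n = 0 then 1 else c * of_nat (dsigma k n))"

lemma eis_fps_mult_nth:
  assumes "0 < n"
  shows "(eis_fps c k * eis_fps c' l) $ n
    = c * of_nat (dsigma k n) + c' * of_nat (dsigma l n) + c * c' * of_int (sigma_conv k l n)"
proof -
  have "{0..n} = insert 0 (insert n {1..<n})" using assms by auto
  then have "(eis_fps c k * eis_fps c' l) $ n
    = c * of_nat (dsigma k n) + c' * of_nat (dsigma l n)
      + (\<Sum>i = 1..<n. c * c' * of_int (int (dsigma k i) * int (dsigma l (n - i))))"
    using assms by (auto simp: fps_mult_nth eis_fps_def intro!: sum.cong)
  then show ?thesis by (simp add: sigma_conv_def sum_distrib_left)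
qed

text \<open>The operator \<open>fps_X * fps_deriv\<close> is \<open>q d/dq\<close>, the formal
  counterpart of the normalised derivative in \<open>z\<close>.\<close>

lemma fps_X_deriv_nth: "(fps_X * fps_deriv f) $ n = of_nat n * (f $ n :: complex)"
  by (cases n) auto

lemma ramanujan_E4_fps:
  "fps_X * fps_deriv (eis_fps 240 3)
    = fps_const (1/3) * (eis_fps (- 24) 1 * eis_fps 240 3 - eis_fps (- 504) 5)"
proof (rule fps_ext)
  fix n
  show "(fps_X * fps_deriv (eis_fps 240 3)) $ n
    = (fps_const (1/3) * (eis_fps (- 24) 1 * eis_fps 240 3 - eis_fps (- 504) 5)) $ n"
  proof (cases "n = 0")
    case False
    then have "of_int (240 * sigma_conv 1 3 n) = (of_int (21 * int (dsigma 5 n) + 10 * int (dsigma 3 n)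
        - int (dsigma 1 n) - 30 * int n * int (dsigma 3 n)) :: complex)"
      by (subst sigma_conv_commute, subst sigma_conv_3_1) auto
    then have conv: "240 * of_int (sigma_conv 1 3 n) = (21 * of_nat (dsigma 5 n) + 10 * of_nat (dsigma 3 n)
        - of_nat (dsigma 1 n) - 30 * of_nat n * of_nat (dsigma 3 n) :: complex)"
      by (simp only: of_int_mult of_int_add of_int_diff of_int_numeral of_int_of_nat_eq)
    have "(eis_fps (- 24) 1 * eis_fps 240 3) $ n = - 24 * of_nat (dsigma 1 n)
        + 240 * of_nat (dsigma 3 n) - 24 * (240 * of_int (sigma_conv 1 3 n))"
      using False by (simp add: eis_fps_mult_nth)
    then show ?thesis using False
      unfolding conv fps_X_deriv_nth fps_mult_left_const_nth fps_sub_nth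
      by (simp add: eis_fps_def algebra_simps)
  qed (simp add: eis_fps_def)
qed

text \<open>This trades the seventh-power divisor sums in \<open>sigma_conv_5_1\<close> for
  coefficients of the square of \<open>E4\<close>.\<close>

lemma eis_fps_E8: "eis_fps 240 3 * eis_fps 240 3 = eis_fps 480 7"
proof (rule fps_ext)
  fix n
  show "(eis_fps 240 3 * eis_fps 240 3) $ n = eis_fps 480 7 $ n"
  proof (cases "n = 0")
    case False
    then have "of_int (120 * sigma_conv 3 3 n) = (of_int (int (dsigma 7 n) - int (dsigma 3 n)) :: complex)"
      by (subst sigma_conv_3_3) auto
    then have conv: "120 * of_int (sigma_conv 3 3 n) = (of_nat (dsigma 7 n) - of_nat (dsigma 3 n) :: complex)"
      by (simp only: of_int_mult of_int_add of_int_diff of_int_numeral of_int_of_nat_eq)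
    have "(eis_fps 240 3 * eis_fps 240 3) $ n = 480 * of_nat (dsigma 3 n)
        + 480 * (120 * of_int (sigma_conv 3 3 n))"
      using False by (simp add: eis_fps_mult_nth)
    then show ?thesis using False
      unfolding conv by (simp add: eis_fps_def algebra_simps)
  qed (simp add: eis_fps_def)
qed

lemma ramanujan_E6_fps:
  "fps_X * fps_deriv (eis_fps (- 504) 5)
    = fps_const (1/2) * (eis_fps (- 24) 1 * eis_fps (- 504) 5 - eis_fps 240 3 * eis_fps 240 3)"
proof (rule fps_ext)
  fix n
  show "(fps_X * fps_deriv (eis_fps (- 504) 5)) $ n
    = (fps_const (1/2) * (eis_fps (- 24) 1 * eis_fps (- 504) 5 - eis_fps 240 3 * eis_fps 240 3)) $ n"
  proof (cases "n = 0")
    case False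
    then have "of_int (504 * sigma_conv 1 5 n) = (of_int (20 * int (dsigma 7 n) + 21 * int (dsigma 5 n)
        + int (dsigma 1 n) - 42 * int n * int (dsigma 5 n)) :: complex)"
      by (subst sigma_conv_commute, subst sigma_conv_5_1) auto
    then have conv: "504 * of_int (sigma_conv 1 5 n) = (20 * of_nat (dsigma 7 n) + 21 * of_nat (dsigma 5 n)
        + of_nat (dsigma 1 n) - 42 * of_nat n * of_nat (dsigma 5 n) :: complex)"
      by (simp only: of_int_mult of_int_add of_int_diff of_int_numeral of_int_of_nat_eq)
    have "(eis_fps (- 24) 1 * eis_fps (- 504) 5) $ n = - 24 * of_nat (dsigma 1 n)
        - 504 * of_nat (dsigma 5 n) + 24 * (504 * of_int (sigma_conv 1 5 n))"
      using False by (simp add: eis_fps_mult_nth)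
    then show ?thesis using False
      unfolding conv fps_X_deriv_nth fps_mult_left_const_nth fps_sub_nth eis_fps_E8
      by (simp add: eis_fps_def algebra_simps)
  qed (simp add: eis_fps_def)
qed

section \<open>Convergence on the unit disc and differentiation in \<open>z\<close>\<close>

lemma dsigma_le: "dsigma k n \<le> n ^ Suc k"
proof (cases "n = 0")
  case False
  have "dsigma k n \<le> (\<Sum>d\<in>{d. d dvd n}. n ^ k)"
    unfolding dsigma_def using False by (intro sum_mono power_mono) (auto dest: dvd_imp_le)
  also have "\<dots> = card {d. d dvd n} * n ^ k" by simp
  also have "card {d. d dvd n} \<le> card {1..n}"
    using False by (intro card_mono) (auto dest: dvd_imp_le dvd_pos_nat simp: Suc_le_eq)
  finally show ?thesis by simp
qed (simp add: dsigma_def)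

text \<open>Applying \<open>q d/dq\<close> raises the exponent by one and does not shrink the disc
  of convergence; the start is the geometric series.\<close>

lemma fps_conv_radius_powers: "1 \<le> fps_conv_radius (Abs_fps (\<lambda>n. of_nat n ^ k :: complex))"
proof (induction k)
  case 0
  show ?case unfolding fps_conv_radius_def
    by (rule conv_radius_geI_ex') (simp add: summable_geometric)
next
  case (Suc k)
  have "Abs_fps (\<lambda>n. of_nat n ^ Suc k :: complex) = fps_X * fps_deriv (Abs_fps (\<lambda>n. of_nat n ^ k))"
    by (rule fps_ext) (simp add: fps_X_deriv_nth del: of_nat_Suc)
  moreover have "1 \<le> fps_conv_radius (fps_deriv (Abs_fps (\<lambda>n. of_nat n ^ k :: complex)))"
    using Suc.IH fps_conv_radius_deriv order_trans by blast
  ultimately show ?case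
    using fps_conv_radius_mult_ge[of 1 fps_X "fps_deriv (Abs_fps (\<lambda>n. of_nat n ^ k :: complex))"] by simp
qed

lemma fps_conv_radius_eis: "1 \<le> fps_conv_radius (eis_fps c k)"
proof -
  have "1 \<le> fps_conv_radius (fps_const c * Abs_fps (\<lambda>n. of_nat n ^ Suc k :: complex))"
    by (rule fps_conv_radius_mult_ge) (use fps_conv_radius_powers[of "Suc k"] in auto)
  also have "\<dots> \<le> fps_conv_radius (eis_fps c k)"
    unfolding fps_conv_radius_def
  proof (subst (1 2) conv_radius_altdef, rule Liminf_mono, rule eventually_mono[OF eventually_gt_at_top[of 0]])
    \<comment> \<open>At index 0 the coefficients are 1 and 0, so the comparison fails there; the
      root formula for the radius only asks for it eventually.\<close>
    fix n :: nat assume "0 < n"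
    moreover have "real (dsigma k n) \<le> real n ^ Suc k"
      using dsigma_le[of k n] by (metis of_nat_le_iff of_nat_power)
    ultimately have "norm (eis_fps c k $ n) \<le> norm ((fps_const c * Abs_fps (\<lambda>n. of_nat n ^ Suc k :: complex)) $ n)"
      by (simp add: eis_fps_def norm_mult norm_power mult_left_mono)
    then show "inverse (ereal (root n (norm ((fps_const c * Abs_fps (\<lambda>n. of_nat n ^ Suc k :: complex)) $ n))))
        \<le> inverse (ereal (root n (norm (eis_fps c k $ n))))"
      using \<open>0 < n\<close> by (intro ereal_inverse_antimono) (auto simp: real_root_ge_zero)
  qed
  finally show ?thesis .
qed

lemma open_uhp: "open uhp"
  unfolding uhp_def by (rule open_halfspace_Im_gt)

lemma norm_qexp_less_1: "z \<in> uhp \<Longrightarrow> norm (qexp z) < 1"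
  by (simp add: qexp_def uhp_def)

lemma qexp_has_field_derivative: "(qexp has_field_derivative 2 * of_real pi * \<i> * qexp z) (at z)"
  unfolding qexp_def by (auto intro!: derivative_eq_intros)

lemma eval_eis_fps:
  assumes "norm q < 1"
  shows "eval_fps (eis_fps c k) q = 1 + c * (\<Sum>n. of_nat (dsigma k (Suc n)) * q ^ Suc n)"
proof -
  have conv: "ereal (norm q) < fps_conv_radius (eis_fps c k)" for c :: complex
    using fps_conv_radius_eis[of c k] assms by (metis ereal_less(3) order_less_le_trans)
  have "summable (\<lambda>n. eis_fps 1 k $ n * q ^ n)" using conv by (rule summable_fps)
  then have "summable (\<lambda>n. eis_fps 1 k $ Suc n * q ^ Suc n)"
    by (subst summable_Suc_iff)
  then have s: "summable (\<lambda>n. of_nat (dsigma k (Suc n)) * q ^ Suc n)" by (simp add: eis_fps_def)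
  have "eval_fps (eis_fps c k) q = 1 + (\<Sum>n. eis_fps c k $ Suc n * q ^ Suc n)"
    unfolding eval_fps_def using suminf_split_head[OF summable_fps[OF conv]] by (simp add: eis_fps_def)
  also have "(\<Sum>n. eis_fps c k $ Suc n * q ^ Suc n) = (\<Sum>n. c * (of_nat (dsigma k (Suc n)) * q ^ Suc n))"
    by (simp add: eis_fps_def mult.assoc)
  also have "\<dots> = c * (\<Sum>n. of_nat (dsigma k (Suc n)) * q ^ Suc n)"
    by (rule suminf_mult[OF s])
  finally show ?thesis .
qed

lemma
  assumes "z \<in> uhp"
  shows E2_eq_eval_fps: "E2 z = eval_fps (eis_fps (- 24) 1) (qexp z)"
    and E4_eq_eval_fps: "E4 z = eval_fps (eis_fps 240 3) (qexp z)"
    and E6_eq_eval_fps: "E6 z = eval_fps (eis_fps (- 504) 5) (qexp z)"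
  by (simp_all add: eval_eis_fps[OF norm_qexp_less_1[OF assms]] E2_def E4_def E6_def)

lemma conv_radius_gt_qexp: "z \<in> uhp \<Longrightarrow> 1 \<le> fps_conv_radius f \<Longrightarrow> ereal (norm (qexp z)) < fps_conv_radius f"
  using norm_qexp_less_1 by (metis ereal_less(3) order_less_le_trans)

text \<open>The chain rule with \<open>q' = 2 pi i q\<close> produces \<open>q d/dq\<close>. The
  function \<open>g\<close> is kept apart from the evaluated series because the Eisenstein series
  agree with their evaluations only on the open set \<open>uhp\<close>.\<close>

lemma eval_fps_qexp_has_field_derivative:
  assumes z: "z \<in> uhp" and f: "1 \<le> fps_conv_radius f"
    and g: "\<And>z. z \<in> uhp \<Longrightarrow> g z = eval_fps f (qexp z)"
  shows "(g has_field_derivative 2 * of_real pi * \<i> * eval_fps (fps_X * fps_deriv f) (qexp z)) (at z)"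
proof -
  have f': "1 \<le> fps_conv_radius (fps_deriv f)" using f fps_conv_radius_deriv order_trans by blast
  have "((\<lambda>z. eval_fps f (qexp z)) has_field_derivative eval_fps (fps_deriv f) (qexp z) * (2 * of_real pi * \<i> * qexp z)) (at z)"
    by (rule has_field_derivative_eval_fps'[OF conv_radius_gt_qexp[OF z f] qexp_has_field_derivative])
  then have "(g has_field_derivative eval_fps (fps_deriv f) (qexp z) * (2 * of_real pi * \<i> * qexp z)) (at z)"
    by (rule has_field_derivative_transform_within_open[OF _ open_uhp z]) (simp add: g)
  then show ?thesis
    using conv_radius_gt_qexp[OF z f'] by (simp add: eval_fps_mult mult_ac)
qed

lemma
  shows E2_holomorphic: "E2 holomorphic_on uhp"
    and E4_holomorphic: "E4 holomorphic_on uhp"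
    and E6_holomorphic: "E6 holomorphic_on uhp"
  unfolding holomorphic_on_open[OF open_uhp]
  using eval_fps_qexp_has_field_derivative[OF _ fps_conv_radius_eis E2_eq_eval_fps]
    eval_fps_qexp_has_field_derivative[OF _ fps_conv_radius_eis E4_eq_eval_fps]
    eval_fps_qexp_has_field_derivative[OF _ fps_conv_radius_eis E6_eq_eval_fps]
  by blast+

lemma eis_fps_product_conv_radius: "1 \<le> fps_conv_radius (eis_fps c k * eis_fps c' l)"
  by (intro fps_conv_radius_mult_ge fps_conv_radius_eis)

lemma ramanujan_E4:
  assumes "z \<in> uhp"
  shows "deriv E4 z / (2 * of_real pi * \<i>) = (E2 z * E4 z - E6 z) / 3"
proof -
  note cr = conv_radius_gt_qexp[OF assms]
  have "1 \<le> fps_conv_radius (eis_fps (- 24) 1 * eis_fps 240 3 - eis_fps (- 504) 5)"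
    using fps_conv_radius_diff[of "eis_fps (- 24) 1 * eis_fps 240 3" "eis_fps (- 504) 5"]
      eis_fps_product_conv_radius fps_conv_radius_eis by (meson min.boundedI order_trans)
  then have "eval_fps (fps_X * fps_deriv (eis_fps 240 3)) (qexp z) = (E2 z * E4 z - E6 z) / 3"
    unfolding ramanujan_E4_fps
    using assms by (simp add: eval_fps_mult eval_fps_diff cr fps_conv_radius_eis eis_fps_product_conv_radius
        E2_eq_eval_fps E4_eq_eval_fps E6_eq_eval_fps)
  then show ?thesis
    using DERIV_imp_deriv[OF eval_fps_qexp_has_field_derivative[OF assms fps_conv_radius_eis E4_eq_eval_fps]]
    by simp
qed

lemma ramanujan_E6:
  assumes "z \<in> uhp"
  shows "deriv E6 z / (2 * of_real pi * \<i>) = (E2 z * E6 z - E4 z ^ 2) / 2"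
proof -
  note cr = conv_radius_gt_qexp[OF assms]
  have "1 \<le> fps_conv_radius (eis_fps (- 24) 1 * eis_fps (- 504) 5 - eis_fps 240 3 * eis_fps 240 3)"
    using fps_conv_radius_diff[of "eis_fps (- 24) 1 * eis_fps (- 504) 5" "eis_fps 240 3 * eis_fps 240 3"]
      eis_fps_product_conv_radius fps_conv_radius_eis by (meson min.boundedI order_trans)
  then have "eval_fps (fps_X * fps_deriv (eis_fps (- 504) 5)) (qexp z) = (E2 z * E6 z - E4 z ^ 2) / 2"
    unfolding ramanujan_E6_fps
    using assms by (simp add: eval_fps_mult eval_fps_diff cr fps_conv_radius_eis eis_fps_product_conv_radius
        E2_eq_eval_fps E4_eq_eval_fps E6_eq_eval_fps power2_eq_square)
  then show ?thesis
    using DERIV_imp_deriv[OF eval_fps_qexp_has_field_derivative[OF assms fps_conv_radius_eis E6_eq_eval_fps]]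
    by simp
qed

section \<open>Algebraic independence of \<open>E4\<close> and \<open>E6\<close>\<close>


lemma Delta_holomorphic: "Delta holomorphic_on uhp"
  unfolding Delta_def by (intro holomorphic_intros E4_holomorphic E6_holomorphic) auto

text \<open>The two Ramanujan identities contribute \<open>E4\<^sup>2 E6\<close> with opposite
  signs, leaving a multiple of \<open>E2\<close>. As \<open>12 / 12 = 1\<close>,
  \<open>Delta\<close> in weight 12 is annihilated by the Serre derivative.\<close>

lemma deriv_Delta:
  assumes "z \<in> uhp"
  shows "deriv Delta z / (2 * of_real pi * \<i>) = E2 z * Delta z"
proof -
  define c where "c = 2 * of_real pi * \<i>"
  have c: "c \<noteq> 0" by (simp add: c_def)
  have "deriv E4 z = c * ((E2 z * E4 z - E6 z) / 3)"
    using c by (simp flip: ramanujan_E4[OF assms, folded c_def])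
  then have 4: "(E4 has_field_derivative c * ((E2 z * E4 z - E6 z) / 3)) (at z)"
    using holomorphic_derivI[OF E4_holomorphic open_uhp assms] by metis
  have "deriv E6 z = c * ((E2 z * E6 z - E4 z ^ 2) / 2)"
    using c by (simp flip: ramanujan_E6[OF assms, folded c_def])
  then have 6: "(E6 has_field_derivative c * ((E2 z * E6 z - E4 z ^ 2) / 2)) (at z)"
    using holomorphic_derivI[OF E6_holomorphic open_uhp assms] by metis
  have "((\<lambda>z. (E4 z ^ 3 - E6 z ^ 2) / 1728) has_field_derivative c * (E2 z * Delta z)) (at z)"
    by (rule DERIV_cong, rule DERIV_cdivide, rule DERIV_diff, rule DERIV_power, rule 4, rule DERIV_power, rule 6)
      (simp add: Delta_def field_simps eval_nat_numeral)
  then have "deriv Delta z = c * (E2 z * Delta z)"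
    unfolding Delta_def[abs_def] by (rule DERIV_imp_deriv)
  then show ?thesis unfolding c_def[symmetric] using c by simp
qed

section \<open>Size of the divisor series on the real unit interval\<close>

definition sigma_series :: "nat \<Rightarrow> real \<Rightarrow> real" where
  "sigma_series k q = (\<Sum>n. real (dsigma k (Suc n)) * q ^ Suc n)"

lemma summable_sigma_series:
  assumes "norm q < 1"
  shows "summable (\<lambda>n. of_nat (dsigma k (Suc n)) * q ^ Suc n :: complex)"
proof -
  have "ereal (norm q) < fps_conv_radius (eis_fps 1 k)"
    using fps_conv_radius_eis[of 1 k] assms by (metis ereal_less(3) order_less_le_trans)
  then have "summable (\<lambda>n. eis_fps 1 k $ n * q ^ n)" by (rule summable_fps)
  then have "summable (\<lambda>n. eis_fps 1 k $ Suc n * q ^ Suc n)" by (subst summable_Suc_iff)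
  then show ?thesis by (simp add: eis_fps_def)
qed

lemma sigma_series_sums:
  assumes "0 \<le> q" "q < 1"
  shows "(\<lambda>n. real (dsigma k (Suc n)) * q ^ Suc n) sums sigma_series k q"
proof -
  have "summable (\<lambda>n. complex_of_real (real (dsigma k (Suc n)) * q ^ Suc n))"
    using summable_sigma_series[of "of_real q" k] assms by simp
  then show ?thesis
    unfolding sigma_series_def by (subst (asm) summable_complex_of_real) (rule summable_sums)
qed

lemma sigma_series_of_real:
  assumes "0 \<le> q" "q < 1"
  shows "(\<Sum>n. of_nat (dsigma k (Suc n)) * complex_of_real q ^ Suc n) = of_real (sigma_series k q)"
  using sums_of_real[OF sigma_series_sums[OF assms, of k], where 'a = complex]
  by (simp add: sums_iff)

lemma dsigma_1: "dsigma k (Suc 0) = 1"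
  by (simp add: dsigma_def)

text \<open>All coefficients are nonnegative and the first one is 1, so the linear term alone bounds
  the increment. The case \<open>p = 0\<close> gives positivity.\<close>

lemma sigma_series_diff_ge:
  assumes "0 \<le> p" "p \<le> q" "q < 1"
  shows "q - p \<le> sigma_series k q - sigma_series k p"
proof -
  let ?f = "\<lambda>n. real (dsigma k (Suc n)) * q ^ Suc n - real (dsigma k (Suc n)) * p ^ Suc n"
  have s: "?f sums (sigma_series k q - sigma_series k p)"
    using assms by (intro sums_diff sigma_series_sums) auto
  have nn: "0 \<le> ?f n" for n
    using assms by (simp add: mult_left_mono power_mono mult_mono del: power_Suc)
  have "sum ?f {0} \<le> suminf ?f"
    by (rule sum_le_suminf) (use s nn in \<open>auto simp: sums_iff\<close>)
  then show ?thesis using s by (simp add: sums_iff dsigma_1)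
qed

text \<open>Splitting off one factor \<open>q\<close> and bounding the others by
  \<open>1 / 2\<close> yields a bound linear in \<open>q\<close>, which keeps \<open>E6\<close>
  positive for small \<open>q\<close>.\<close>

lemma sigma_series_le:
  assumes "0 \<le> q" "q \<le> 1 / 2"
  shows "sigma_series k q \<le> 2 * q * sigma_series k (1 / 2)"
proof -
  have "(\<lambda>n. 2 * q * (real (dsigma k (Suc n)) * (1 / 2) ^ Suc n)) sums (2 * q * sigma_series k (1 / 2))"
    by (intro sums_mult sigma_series_sums) auto
  moreover have "real (dsigma k (Suc n)) * q ^ Suc n \<le> 2 * q * (real (dsigma k (Suc n)) * (1 / 2) ^ Suc n)" for n
  proof -
    have "q ^ Suc n \<le> 2 * q * (1 / 2) ^ Suc n"
      using assms power_mono[of q "1 / 2" n] by (simp add: mult_left_mono)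
    then have "real (dsigma k (Suc n)) * q ^ Suc n \<le> real (dsigma k (Suc n)) * (2 * q * (1 / 2) ^ Suc n)"
      by (rule mult_left_mono) simp
    then show ?thesis by (simp only: mult_ac)
  qed
  moreover have "(\<lambda>n. real (dsigma k (Suc n)) * q ^ Suc n) sums sigma_series k q"
    using assms by (intro sigma_series_sums) auto
  ultimately show ?thesis
    by (rule sums_le[rotated -1])
qed

text \<open>On the positive imaginary axis \<open>qexp\<close> takes every value in the real unit
  interval, so \<open>E4\<close> and \<open>E6\<close> become real series there.\<close>

lemma E4_E6_real:
  assumes "0 < q" "q < 1"
  obtains z where "z \<in> uhp" "E4 z = of_real (1 + 240 * sigma_series 3 q)"
    "E6 z = of_real (1 - 504 * sigma_series 5 q)"
proof -
  define z where "z = \<i> * complex_of_real (- ln q / (2 * pi))"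
  have "z \<in> uhp" using assms by (simp add: z_def uhp_def divide_less_0_iff)
  have "qexp z = exp (of_real (ln q))"
    by (simp add: qexp_def z_def field_simps)
  also have "\<dots> = of_real q" using assms by (simp add: exp_of_real)
  finally have q: "qexp z = of_real q" .
  show ?thesis
    by (rule that[OF \<open>z \<in> uhp\<close>]) (use assms in \<open>simp_all add: E4_def E6_def q sigma_series_of_real del: power_Suc\<close>)
qed

text \<open>On a monomial \<open>E4 ^ i * E6 ^ j\<close> of weight \<open>4 i + 6 j = 2 m\<close>, substituting \<open>E4 = r\<^sup>2 \<tau>\<close> and
  \<open>E6 = r\<^sup>3 \<tau>\<close> with \<open>r = E6 / E4\<close> and \<open>\<tau> = E4\<^sup>3 / E6\<^sup>2\<close> gives \<open>r ^ m * \<tau> ^ (i + j)\<close>;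
  so a relation would be a polynomial with infinitely many roots \<open>\<tau>\<close>. Only points with
  \<open>Delta z \<noteq> 0\<close> enter, so a common factor \<open>Delta\<close> may be cancelled first.\<close>

lemma E4_E6_independent:
  fixes c :: "nat \<Rightarrow> nat \<Rightarrow> complex"
  assumes S: "finite S" and wt: "\<And>i j. (i, j) \<in> S \<Longrightarrow> 4 * i + 6 * j = n"
    and zero: "\<And>z. z \<in> uhp \<Longrightarrow> Delta z \<noteq> 0 \<Longrightarrow> (\<Sum>(i, j) \<in> S. c i j * E4 z ^ i * E6 z ^ j) = 0"
    and ij: "(i, j) \<in> S"
  shows "c i j = 0"
proof -
  define s where "s = sigma_series 5 (1 / 2)"
  have spos: "0 < s"
    using sigma_series_diff_ge[of 0 "1 / 2" 5] by (simp add: s_def sigma_series_def)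
  \<comment> \<open>Here \<open>1008 = 2 * 504\<close>: by \<open>sigma_series_le\<close>,
    \<open>504 * sigma_series 5 q \<le> 1008 * q * s < 1\<close> for \<open>q < e\<close>, hence
    \<open>b q > 0\<close>.\<close>
  define e where "e = min (1 / 2) (1 / (1008 * s))"
  have e: "0 < e" "e \<le> 1 / 2" using spos by (auto simp: e_def)
  define a where "a q = 1 + 240 * sigma_series 3 q" for q
  define b where "b q = 1 - 504 * sigma_series 5 q" for q
  define t where "t q = a q ^ 3 / b q ^ 2" for q
  have agt: "1 < a q" if "q \<in> {0<..<e}" for q
    using sigma_series_diff_ge[of 0 q 3] that e by (simp add: a_def sigma_series_def)
  then have apos: "0 < a q" if "q \<in> {0<..<e}" for q using that by fastforce
  have bpos: "0 < b q" if "q \<in> {0<..<e}" for q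
  proof -
    have "q < 1 / (1008 * s)" using that by (simp add: e_def)
    then have "q * (1008 * s) < 1" using spos by (simp add: pos_less_divide_eq)
    moreover have "sigma_series 5 q \<le> 2 * q * s"
      unfolding s_def using that e by (intro sigma_series_le) auto
    ultimately show ?thesis unfolding b_def by (simp add: algebra_simps)
  qed
  \<comment> \<open>The numerator of \<open>t\<close> increases and its denominator decreases;
    strict monotonicity will supply infinitely many roots.\<close>
  have tmono: "t p < t q" if "p \<in> {0<..<e}" "q \<in> {0<..<e}" "p < q" for p q
  proof -
    have "a p < a q" using sigma_series_diff_ge[of p q 3] that e by (simp add: a_def)
    moreover have "b q < b p" using sigma_series_diff_ge[of p q 5] that e by (simp add: b_def)
    ultimately show ?thesis
      unfolding t_def using apos[OF that(1)] bpos[OF that(2)]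
      by (intro frac_less power_strict_mono power_mono) auto
  qed
  define P where "P = (\<Sum>(i, j) \<in> S. monom (c i j) (i + j))"
  have root: "poly P (of_real (t q)) = 0" if q: "q \<in> {0<..<e}" for q
  proof -
    define r where "r = b q / a q"
    have pos: "a q \<noteq> 0" "b q \<noteq> 0" using apos[OF q] bpos[OF q] by auto
    have ab: "a q = r ^ 2 * t q" "b q = r ^ 3 * t q"
      using pos by (simp_all add: r_def t_def field_simps eval_nat_numeral)
    obtain z where z: "z \<in> uhp" "E4 z = of_real (a q)" "E6 z = of_real (b q)"
      using E4_E6_real[of q] q e unfolding a_def b_def by auto
    have "c i j * E4 z ^ i * E6 z ^ j = of_real (r ^ (n div 2)) * poly (monom (c i j) (i + j)) (of_real (t q))"
      if "(i, j) \<in> S" for i j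
    proof -
      have n: "n div 2 = 2 * i + 3 * j" using wt[OF that] by auto
      have "a q ^ i * b q ^ j = r ^ (n div 2) * t q ^ (i + j)"
        unfolding n by (subst ab(1), subst ab(2))
          (simp only: power_add power_mult[symmetric] power_mult_distrib mult_ac)
      then have "complex_of_real (a q ^ i * b q ^ j) = complex_of_real (r ^ (n div 2) * t q ^ (i + j))"
        by (rule arg_cong)
      then show ?thesis unfolding z(2,3) poly_monom by (simp add: mult_ac)
    qed
    then have "(\<Sum>(i, j) \<in> S. c i j * E4 z ^ i * E6 z ^ j) = of_real (r ^ (n div 2)) * poly P (of_real (t q))"
      unfolding P_def poly_sum sum_distrib_left by (intro sum.cong) auto
    moreover have "Delta z \<noteq> 0"
    proof -
      have "b q < 1"
        using sigma_series_diff_ge[of 0 q 5] q e by (simp add: b_def sigma_series_def)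
      then have "b q ^ 2 < 1" using bpos[OF q] by (simp add: power_less_one_iff)
      also have "1 < a q ^ 3" using agt[OF q] by (intro one_less_power) auto
      finally have "b q ^ 2 \<noteq> a q ^ 3" by simp
      then have "complex_of_real (a q ^ 3) \<noteq> complex_of_real (b q ^ 2)"
        unfolding of_real_eq_iff by metis
      then show ?thesis unfolding Delta_def z(2,3) by simp
    qed
    ultimately show ?thesis using zero[OF z(1)] pos by (simp add: r_def)
  qed
  have "inj_on (\<lambda>q. complex_of_real (t q)) {0<..<e}"
  proof (rule inj_onI)
    fix p q assume "p \<in> {0<..<e}" "q \<in> {0<..<e}" "complex_of_real (t p) = complex_of_real (t q)"
    then show "p = q" using tmono[of p q] tmono[of q p] by (cases p q rule: linorder_cases) auto
  qed
  then have "infinite ((\<lambda>q. complex_of_real (t q)) ` {0<..<e})"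
    using finite_imageD e infinite_Ioo[of 0 e] by blast
  moreover have "(\<lambda>q. complex_of_real (t q)) ` {0<..<e} \<subseteq> {x. poly P x = 0}" using root by auto
  ultimately have "P = 0" using poly_roots_finite[of P] finite_subset by blast
  \<comment> \<open>Within one weight the degree \<open>i + j\<close> determines the pair
    \<open>(i, j)\<close>, so no two monomials of \<open>P\<close> merge.\<close>
  have "coeff P (i + j) = (\<Sum>x \<in> S. if x = (i, j) then c i j else 0)"
    unfolding P_def coeff_sum
  proof (intro sum.cong refl)
    fix x assume "x \<in> S"
    then show "coeff (case x of (i, j) \<Rightarrow> monom (c i j) (i + j)) (i + j) = (if x = (i, j) then c i j else 0)"
      using wt[of "fst x" "snd x"] wt[OF ij] by (cases x) auto
  qed
  also have "\<dots> = c i j" using S ij by simp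
  finally show ?thesis using \<open>P = 0\<close> by simp
qed

section \<open>Algebras presented by generators and relations\<close>


text \<open>Summing over splittings treats both factors alike: associativity becomes the
  rebracketing of factorisations into three words, free of arithmetic with cut positions.\<close>

lemma nc_mult_eq_sum_append:
  "nc_mult p q w = (\<Sum>(u, v) \<in> {(u, v). u @ v = w}. p u * q v)"
  unfolding nc_mult_def
  by (rule sum.reindex_bij_witness[where j = "\<lambda>i. (take i w, drop i w)" and i = "\<lambda>(u, v). length u"])
    (auto simp: min_def)

lemma finite_append_eq: "finite {(u, v). u @ v = w}"
proof (rule finite_subset)
  show "{(u, v). u @ v = w} \<subseteq> (\<lambda>i. (take i w, drop i w)) ` {..length w}"
  proof
    fix x assume "x \<in> {(u, v). u @ v = w}"
    then obtain u v where "x = (u, v)" "w = u @ v" by auto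
    then show "x \<in> (\<lambda>i. (take i w, drop i w)) ` {..length w}"
      by (intro image_eqI[of _ _ "length u"]) auto
  qed
qed auto

lemma nc_mult_assoc: "nc_mult (nc_mult p q) r = nc_mult p (nc_mult q r)"
proof
  fix w
  have "nc_mult (nc_mult p q) r w
      = (\<Sum>(u, v) \<in> {(u, v). u @ v = w}. \<Sum>(a, b) \<in> {(a, b). a @ b = u}. p a * q b * r v)"
    unfolding nc_mult_eq_sum_append sum_distrib_right by (simp add: case_prod_unfold)
  also have "\<dots> = (\<Sum>((u, v), a, b) \<in> Sigma {(u, v). u @ v = w} (\<lambda>(u, v). {(a, b). a @ b = u}). p a * q b * r v)"
    by (subst sum.Sigma[symmetric]) (use finite_append_eq in \<open>auto simp: case_prod_unfold intro!: sum.cong\<close>)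
  also have "\<dots> = (\<Sum>((u, v), a, b) \<in> Sigma {(u, v). u @ v = w} (\<lambda>(u, v). {(a, b). a @ b = v}). p u * q a * r b)"
    by (rule sum.reindex_bij_witness[where j = "\<lambda>((u, v), a, b). ((a, b @ v), b, v)"
          and i = "\<lambda>((u, v), a, b). ((u @ a, b), u, a)"]) auto
  also have "\<dots> = (\<Sum>(u, v) \<in> {(u, v). u @ v = w}. \<Sum>(a, b) \<in> {(a, b). a @ b = v}. p u * q a * r b)"
    by (subst sum.Sigma[symmetric]) (use finite_append_eq in \<open>auto simp: case_prod_unfold intro!: sum.cong\<close>)
  also have "\<dots> = nc_mult p (nc_mult q r) w"
    unfolding nc_mult_eq_sum_append sum_distrib_left by (simp add: case_prod_unfold mult.assoc)
  finally show "nc_mult (nc_mult p q) r w = nc_mult p (nc_mult q r) w" .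
qed

lemma nc_one_mult: "nc_mult nc_one p = p"
proof
  fix w
  have "nc_mult nc_one p w = (\<Sum>i\<le>length w. if i = 0 then p w else 0)"
    unfolding nc_mult_def nc_one_def by (rule sum.cong) auto
  then show "nc_mult nc_one p w = p w" by simp
qed

lemma nc_mult_one: "nc_mult p nc_one = p"
proof
  fix w
  have "nc_mult p nc_one w = (\<Sum>i\<le>length w. if i = length w then p w else 0)"
    unfolding nc_mult_def nc_one_def by (rule sum.cong) auto
  then show "nc_mult p nc_one w = p w" by simp
qed

lemma nc_mult_add_left: "nc_mult (nc_add p q) r = nc_add (nc_mult p r) (nc_mult q r)"
  by (auto simp: nc_mult_def nc_add_def algebra_simps sum.distrib)

lemma nc_mult_add_right: "nc_mult r (nc_add p q) = nc_add (nc_mult r p) (nc_mult r q)"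
  by (auto simp: nc_mult_def nc_add_def algebra_simps sum.distrib)

lemma nc_mult_diff_left: "nc_mult (nc_diff p q) r = nc_diff (nc_mult p r) (nc_mult q r)"
  by (auto simp: nc_mult_def nc_diff_def algebra_simps sum_subtractf)

lemma nc_mult_diff_right: "nc_mult r (nc_diff p q) = nc_diff (nc_mult r p) (nc_mult r q)"
  by (auto simp: nc_mult_def nc_diff_def algebra_simps sum_subtractf)

lemma nc_smult_mult_left: "nc_mult (nc_smult c p) q = nc_smult c (nc_mult p q)"
  by (auto simp: nc_mult_def nc_smult_def sum_distrib_left mult_ac)

lemma nc_smult_mult_right: "nc_mult p (nc_smult c q) = nc_smult c (nc_mult p q)"
  by (auto simp: nc_mult_def nc_smult_def sum_distrib_left mult_ac)

lemma ncT_zero: "nc_zero \<in> ncT"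
  by (simp add: ncT_def nc_zero_def)

lemma ncT_one: "nc_one \<in> ncT"
  by (simp add: ncT_def nc_one_def)

lemma ncT_var: "nc_var a \<in> ncT"
  by (simp add: ncT_def nc_var_def)

lemma ncT_add: "p \<in> ncT \<Longrightarrow> q \<in> ncT \<Longrightarrow> nc_add p q \<in> ncT"
  unfolding ncT_def nc_add_def mem_Collect_eq
  by (rule finite_subset[of _ "{w. p w \<noteq> 0} \<union> {w. q w \<noteq> 0}"]) auto

lemma ncT_diff: "p \<in> ncT \<Longrightarrow> q \<in> ncT \<Longrightarrow> nc_diff p q \<in> ncT"
  unfolding ncT_def nc_diff_def mem_Collect_eq
  by (rule finite_subset[of _ "{w. p w \<noteq> 0} \<union> {w. q w \<noteq> 0}"]) auto

lemma ncT_smult: "p \<in> ncT \<Longrightarrow> nc_smult c p \<in> ncT"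
  unfolding ncT_def nc_smult_def mem_Collect_eq
  by (rule finite_subset[of _ "{w. p w \<noteq> 0}"]) auto

lemma nc_mult_support: "{w. nc_mult p q w \<noteq> 0} \<subseteq> (\<lambda>(u, v). u @ v) ` ({w. p w \<noteq> 0} \<times> {w. q w \<noteq> 0})"
proof
  fix w assume "w \<in> {w. nc_mult p q w \<noteq> 0}"
  then obtain i where "p (take i w) * q (drop i w) \<noteq> 0"
    unfolding nc_mult_def by (auto elim: sum.not_neutral_contains_not_neutral)
  then show "w \<in> (\<lambda>(u, v). u @ v) ` ({w. p w \<noteq> 0} \<times> {w. q w \<noteq> 0})"
    by (intro image_eqI[of _ _ "(take i w, drop i w)"]) auto
qed

lemma ncT_mult: "p \<in> ncT \<Longrightarrow> q \<in> ncT \<Longrightarrow> nc_mult p q \<in> ncT"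
  unfolding ncT_def mem_Collect_eq by (rule finite_subset[OF nc_mult_support]) auto

lemma ncT_comm: "p \<in> ncT \<Longrightarrow> q \<in> ncT \<Longrightarrow> nc_comm p q \<in> ncT"
  unfolding nc_comm_def by (intro ncT_diff ncT_mult)

lemmas ncT_closed = ncT_zero ncT_one ncT_var ncT_add ncT_diff ncT_smult ncT_mult ncT_comm

text \<open>Scalars are multiples of \<open>nc_one\<close>, so absorption of products already covers
  them, and with \<open>c = - 1\<close> also negation.\<close>

lemma nc_ideal_smult:
  assumes "p \<in> nc_ideal G"
  shows "nc_smult c p \<in> nc_ideal G"
proof -
  have "nc_mult (nc_smult c nc_one) p \<in> nc_ideal G"
    using assms by (intro nc_ideal.lmult ncT_closed)
  then show ?thesis by (simp add: nc_smult_mult_left nc_one_mult)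
qed

lemma nc_diff_eq: "nc_diff p q = nc_add p (nc_smult (- 1) q)"
  by (auto simp: nc_diff_def nc_add_def nc_smult_def)

lemma nc_ideal_subset_ncT:
  assumes "G \<subseteq> ncT" "p \<in> nc_ideal G"
  shows "p \<in> ncT"
  using assms(2) by induction (use assms(1) in \<open>auto intro: ncT_closed\<close>)

lemma nc_var_mult_Nil: "nc_mult (nc_var a) p [] = 0"
  by (simp add: nc_mult_def nc_var_def)

lemma nc_var_mult_Cons: "nc_mult (nc_var a) p (b # u) = (if a = b then p u else 0)"
proof -
  have "nc_mult (nc_var a) p (b # u) = (\<Sum>i\<le>Suc (length u). if i = 1 then if a = b then p u else 0 else 0)"
    unfolding nc_mult_def
  proof (rule sum.cong)
    fix i assume "i \<in> {..Suc (length u)}"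
    then show "nc_var a (take i (b # u)) * p (drop i (b # u)) = (if i = 1 then if a = b then p u else 0 else 0)"
      by (cases i rule: nat.exhaust; cases u; cases "i - 1") (auto simp: nc_var_def)
  qed simp
  then show ?thesis by (auto simp: Suc_le_eq)
qed

text \<open>A finitely supported function is a sum of weighted words, and a word arises by prefixing
  letters to a constant; left multiplication by letters is thus the only product to
  consider.\<close>

lemma ncT_induct [consumes 1, case_names const add var]:
  assumes p: "p \<in> ncT"
    and const: "\<And>c. P (nc_smult c nc_one)"
    and add: "\<And>p q. p \<in> ncT \<Longrightarrow> q \<in> ncT \<Longrightarrow> P p \<Longrightarrow> P q \<Longrightarrow> P (nc_add p q)"
    and var: "\<And>a p. p \<in> ncT \<Longrightarrow> P p \<Longrightarrow> P (nc_mult (nc_var a) p)"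
  shows "P p"
proof -
  define single :: "'a list \<Rightarrow> complex \<Rightarrow> 'a ncp" where "single w c = (\<lambda>u. if u = w then c else 0)" for w c
  have sT: "single w c \<in> ncT" for w c by (simp add: ncT_def single_def)
  have single: "P (single w c)" for w c
  proof (induction w)
    case Nil
    have "single [] c = nc_smult c nc_one" by (auto simp: single_def nc_smult_def nc_one_def)
    then show ?case using const by simp
  next
    case (Cons a w)
    have "single (a # w) c = nc_mult (nc_var a) (single w c)"
    proof
      fix u show "single (a # w) c u = nc_mult (nc_var a) (single w c) u"
        by (cases u) (auto simp: single_def nc_var_mult_Nil nc_var_mult_Cons)
    qed
    then show ?case using var[OF sT Cons] by simp
  qed
  have "finite {w. p w \<noteq> 0}" using p by (simp add: ncT_def)
  then have "P p \<and> p \<in> ncT"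
  proof (induction "{w. p w \<noteq> 0}" arbitrary: p rule: finite_induct)
    case empty
    then have "p = nc_smult 0 nc_one" by (auto simp: nc_smult_def)
    then show ?case using const[of 0] by (simp add: ncT_closed)
  next
    case (insert w F)
    define q where "q = (\<lambda>u. if u = w then 0 else p u)"
    have "F = {u. q u \<noteq> 0}" using insert(2,4) by (auto simp: q_def)
    from insert(3)[OF this] have "P q" "q \<in> ncT" by auto
    moreover have "p = nc_add (single w (p w)) q" by (auto simp: nc_add_def single_def q_def)
    ultimately show ?case using add[OF sT _ single] ncT_add[OF sT] by metis
  qed
  then show ?thesis ..
qed

text \<open>The relators are attached to the type of generators, so that one quotient type \<open>palg\<close> and one
  universal property serve both \<open>T(V)/I\<close> and the Weyl algebra.\<close>

class presented =
  fixes relators :: "('a list \<Rightarrow> complex) set"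
  assumes relators_ncT: "relators \<subseteq> ncT"

text \<open>A partial equivalence: functions of infinite support lie outside the tensor algebra and
  must not contribute classes.\<close>

definition nc_cong :: "'a::presented ncp \<Rightarrow> 'a ncp \<Rightarrow> bool" where
  "nc_cong p q \<longleftrightarrow> p \<in> ncT \<and> q \<in> ncT \<and> nc_diff p q \<in> nc_ideal relators"

lemma nc_cong_refl: "nc_cong p p \<longleftrightarrow> p \<in> ncT"
  using nc_ideal.zero by (auto simp: nc_cong_def nc_diff_def nc_zero_def)

lemma nc_cong_sym: "nc_cong p q \<Longrightarrow> nc_cong q p"
  unfolding nc_cong_def
  by (auto dest: nc_ideal_smult[of _ _ "- 1"] simp: nc_diff_def nc_smult_def)

lemma nc_cong_trans: "nc_cong p q \<Longrightarrow> nc_cong q r \<Longrightarrow> nc_cong p r"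
  unfolding nc_cong_def
  using nc_ideal.add[of "nc_diff p q" relators "nc_diff q r"] by (auto simp: nc_diff_def nc_add_def)

quotient_type (overloaded) 'a palg = "'a::presented ncp" / partial: nc_cong
proof (rule part_equivpI)
  show "\<exists>p::'a ncp. nc_cong p p" using nc_cong_refl ncT_zero by blast
  show "symp (nc_cong :: 'a ncp \<Rightarrow> _)" by (rule sympI) (rule nc_cong_sym)
  show "transp (nc_cong :: 'a ncp \<Rightarrow> _)" by (rule transpI) (rule nc_cong_trans)
qed

lemma nc_cong_add:
  assumes "nc_cong p p'" "nc_cong q q'"
  shows "nc_cong (nc_add p q) (nc_add p' q')"
proof -
  have "nc_diff (nc_add p q) (nc_add p' q') = nc_add (nc_diff p p') (nc_diff q q')"
    by (auto simp: nc_diff_def nc_add_def)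
  then show ?thesis using assms by (auto simp: nc_cong_def intro: ncT_closed nc_ideal.add)
qed

lemma nc_cong_smult:
  assumes "nc_cong p p'"
  shows "nc_cong (nc_smult c p) (nc_smult c p')"
proof -
  have "nc_diff (nc_smult c p) (nc_smult c p') = nc_smult c (nc_diff p p')"
    by (auto simp: nc_diff_def nc_smult_def algebra_simps)
  then show ?thesis using assms by (auto simp: nc_cong_def intro: ncT_closed nc_ideal_smult)
qed

lemma nc_cong_mult:
  assumes "nc_cong p p'" "nc_cong q q'"
  shows "nc_cong (nc_mult p q) (nc_mult p' q')"
proof -
  have "nc_diff (nc_mult p q) (nc_mult p' q') = nc_add (nc_mult (nc_diff p p') q) (nc_mult p' (nc_diff q q'))"
    unfolding nc_mult_diff_left nc_mult_diff_right by (auto simp: nc_diff_def nc_add_def)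
  then show ?thesis
    using assms by (auto simp: nc_cong_def intro: ncT_closed nc_ideal.add nc_ideal.lmult nc_ideal.rmult)
qed

lemma nc_cong_eqI: "p = q \<Longrightarrow> p \<in> ncT \<Longrightarrow> nc_cong p q"
  by (simp add: nc_cong_refl)

text \<open>Relators may generate the whole algebra, so \<open>0 \<noteq> 1\<close> cannot be part
  of the structure. A ring with a multiplicative monoid still has powers.\<close>

instantiation palg :: (presented) "{ring, monoid_mult}"
begin

lift_definition zero_palg :: "'a palg" is nc_zero by (simp add: nc_cong_refl ncT_closed)
lift_definition one_palg :: "'a palg" is nc_one by (simp add: nc_cong_refl ncT_closed)
lift_definition plus_palg :: "'a palg \<Rightarrow> 'a palg \<Rightarrow> 'a palg" is nc_add by (rule nc_cong_add)
lift_definition uminus_palg :: "'a palg \<Rightarrow> 'a palg" is "nc_smult (- 1)" by (rule nc_cong_smult)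
lift_definition minus_palg :: "'a palg \<Rightarrow> 'a palg \<Rightarrow> 'a palg" is nc_diff
  unfolding nc_diff_eq by (intro nc_cong_add nc_cong_smult)
lift_definition times_palg :: "'a palg \<Rightarrow> 'a palg \<Rightarrow> 'a palg" is nc_mult by (rule nc_cong_mult)

instance
proof
  fix a b c :: "'a palg"
  show "a + b + c = a + (b + c)"
    by (transfer, rule nc_cong_eqI, simp add: nc_add_def add.assoc, simp add: nc_cong_refl ncT_closed)
  show "a + b = b + a"
    by (transfer, rule nc_cong_eqI, simp add: nc_add_def add.commute, simp add: nc_cong_refl ncT_closed)
  show "0 + a = a"
    by (transfer, rule nc_cong_eqI, simp add: nc_add_def nc_zero_def, simp add: nc_cong_refl ncT_closed)
  show "- a + a = 0"
    by (transfer, rule nc_cong_eqI, simp add: nc_add_def nc_zero_def nc_smult_def, simp add: nc_cong_refl ncT_closed)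
  show "a - b = a + - b"
    by (transfer, rule nc_cong_eqI, simp add: nc_diff_eq, simp add: nc_cong_refl ncT_closed)
  show "a * b * c = a * (b * c)"
    by (transfer, rule nc_cong_eqI, simp add: nc_mult_assoc, simp add: nc_cong_refl ncT_closed)
  show "1 * a = a"
    by (transfer, rule nc_cong_eqI, simp add: nc_one_mult, simp add: nc_cong_refl ncT_closed)
  show "a * 1 = a"
    by (transfer, rule nc_cong_eqI, simp add: nc_mult_one, simp add: nc_cong_refl ncT_closed)
  show "(a + b) * c = a * c + b * c"
    by (transfer, rule nc_cong_eqI, simp add: nc_mult_add_left, simp add: nc_cong_refl ncT_closed)
  show "c * (a + b) = c * a + c * b"
    by (transfer, rule nc_cong_eqI, simp add: nc_mult_add_right, simp add: nc_cong_refl ncT_closed)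
qed

end

text \<open>Scalars are represented by central elements, which makes the vector space structure part
  of the ring structure.\<close>

lift_definition cst :: "complex \<Rightarrow> 'a::presented palg" is "\<lambda>c. nc_smult c nc_one"
  by (simp add: nc_cong_refl ncT_closed)

lift_definition gen :: "'a \<Rightarrow> 'a::presented palg" is nc_var
  by (simp add: nc_cong_refl ncT_closed)

lemma abs_palg_cases:
  obtains p where "p \<in> ncT" "z = abs_palg p"
  using palg.abs_induct[of "\<lambda>z. \<exists>p. p \<in> ncT \<and> z = abs_palg p" z] by (auto simp: nc_cong_refl)

lemma abs_palg_eq_iff:
  fixes p q :: "'a::presented ncp"
  assumes "p \<in> ncT" "q \<in> ncT"
  shows "abs_palg p = abs_palg q \<longleftrightarrow> nc_diff p q \<in> nc_ideal relators"
  using Quotient_rel[OF Quotient_palg, of p q] assms nc_cong_refl[of p] nc_cong_refl[of q]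
  unfolding nc_cong_def[of p q] by blast

lemma
  fixes p q :: "'a::presented ncp"
  assumes "p \<in> ncT" "q \<in> ncT"
  shows abs_palg_add: "abs_palg (nc_add p q) = abs_palg p + abs_palg q"
    and abs_palg_diff: "abs_palg (nc_diff p q) = abs_palg p - abs_palg q"
    and abs_palg_mult: "abs_palg (nc_mult p q) = abs_palg p * abs_palg q"
  using assms by (simp_all add: plus_palg.abs_eq minus_palg.abs_eq times_palg.abs_eq nc_cong_refl)

lemma abs_palg_one: "abs_palg nc_one = 1"
  by (simp add: one_palg.abs_eq)

lemma abs_palg_zero: "abs_palg nc_zero = 0"
  by (simp add: zero_palg.abs_eq)

lemma abs_palg_var: "abs_palg (nc_var a) = gen a"
  by (simp add: gen.abs_eq)

lemma abs_palg_smult: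
  assumes "p \<in> ncT"
  shows "abs_palg (nc_smult c p) = cst c * abs_palg p"
  using assms abs_palg_mult[of "nc_smult c nc_one" p]
  by (simp add: cst.abs_eq ncT_closed nc_smult_mult_left nc_one_mult)

lemma abs_palg_comm:
  assumes "p \<in> ncT" "q \<in> ncT"
  shows "abs_palg (nc_comm p q) = abs_palg p * abs_palg q - abs_palg q * abs_palg p"
  using assms by (simp add: nc_comm_def abs_palg_diff abs_palg_mult ncT_closed)

lemma cst_add: "cst (c + d) = cst c + cst d"
  by (transfer, rule nc_cong_eqI, simp add: nc_add_def nc_smult_def algebra_simps, simp add: ncT_closed)

lemma cst_mult: "cst (c * d) = cst c * cst d"
  by (transfer, rule nc_cong_eqI, unfold nc_smult_mult_left nc_one_mult, simp add: nc_smult_def mult.assoc,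
      simp add: ncT_closed)

lemma cst_1 [simp]: "cst 1 = 1"
  by (transfer, rule nc_cong_eqI, simp add: nc_smult_def, simp add: ncT_closed)

lemma cst_0 [simp]: "cst 0 = 0"
  by (transfer, rule nc_cong_eqI, simp add: nc_smult_def nc_zero_def, simp add: ncT_closed)

lemma cst_commute: "z * cst c = cst c * z"
  by (transfer, rule nc_cong_eqI, simp add: nc_smult_mult_left nc_smult_mult_right nc_one_mult nc_mult_one,
      simp add: ncT_closed nc_cong_refl)

lemma cst_left_commute: "y * (cst c * z) = cst c * (y * z)"
  by (metis cst_commute mult.assoc)

lemma cst_uminus: "cst (- c) = - cst c"
  using cst_add[of c "- c"] by (simp add: eq_neg_iff_add_eq_0 add.commute)

lemma relator_zero: "p \<in> relators \<Longrightarrow> abs_palg p = 0"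
  using abs_palg_eq_iff[OF _ ncT_zero, of p] relators_ncT nc_ideal.gen[of p relators]
  unfolding abs_palg_zero by (auto simp: nc_diff_def nc_zero_def)

lemma palg_induct [case_names cst add gen]:
  assumes "\<And>c. P (cst c)" "\<And>x y. P x \<Longrightarrow> P y \<Longrightarrow> P (x + y)" "\<And>a x. P x \<Longrightarrow> P (gen a * x)"
  shows "P z"
proof -
  obtain p where "p \<in> ncT" "z = abs_palg p" by (rule abs_palg_cases)
  from this(1) have "P (abs_palg p)"
  proof (induction rule: ncT_induct)
    case (const c)
    then show ?case using assms(1) by (simp add: cst.abs_eq)
  next
    case (add p q)
    then show ?case using assms(2) by (simp add: abs_palg_add)
  next
    case (var a p)
    then show ?case using assms(3) by (simp add: abs_palg_mult abs_palg_var ncT_closed)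
  qed
  with \<open>z = abs_palg p\<close> show ?thesis by simp
qed

section \<open>Modules given by one linear operator per generator\<close>

locale word_rep = module scale for scale :: "complex \<Rightarrow> 'v::ab_group_add \<Rightarrow> 'v" +
  fixes f :: "'a \<Rightarrow> 'v \<Rightarrow> 'v"
  assumes f_add: "f a (u + v) = f a u + f a v"
    and f_scale: "f a (scale c v) = scale c (f a v)"
begin

text \<open>With \<open>foldr\<close> the last letter acts first, so concatenation of words becomes
  composition of operators.\<close>

definition act :: "'a ncp \<Rightarrow> 'v \<Rightarrow> 'v" where
  "act p v = (\<Sum>w | p w \<noteq> 0. scale (p w) (foldr f w v))"

lemma act_superset:
  assumes "finite F" "{w. p w \<noteq> 0} \<subseteq> F"
  shows "act p v = (\<Sum>w \<in> F. scale (p w) (foldr f w v))"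
  unfolding act_def using assms by (intro sum.mono_neutral_left) auto

lemma act_add:
  assumes "p \<in> ncT" "q \<in> ncT"
  shows "act (nc_add p q) v = act p v + act q v"
proof -
  let ?F = "{w. p w \<noteq> 0} \<union> {w. q w \<noteq> 0}"
  have F: "finite ?F" using assms by (simp add: ncT_def)
  show ?thesis
    by (subst (1 2 3) act_superset[OF F])
      (auto simp: nc_add_def scale_left_distrib sum.distrib)
qed

lemma act_smult:
  assumes "p \<in> ncT"
  shows "act (nc_smult c p) v = scale c (act p v)"
proof -
  have F: "finite {w. p w \<noteq> 0}" using assms by (simp add: ncT_def)
  show ?thesis
    by (subst (1 2) act_superset[OF F])
      (auto simp: nc_smult_def scale_sum_right)
qed

lemma act_diff:
  assumes "p \<in> ncT" "q \<in> ncT"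
  shows "act (nc_diff p q) v = act p v - act q v"
  using assms by (simp add: nc_diff_eq act_add act_smult ncT_closed)

lemma act_zero: "act nc_zero v = 0"
  by (simp add: act_def nc_zero_def)

lemma act_one: "act nc_one v = v"
  by (simp add: act_def nc_one_def)

lemma act_scale_right: "act p (scale c v) = scale c (act p v)"
proof -
  have "foldr f w (scale c v) = scale c (foldr f w v)" for w by (induction w) (auto simp: f_scale)
  then show ?thesis by (simp add: act_def scale_sum_right mult.commute)
qed

lemma act_var_mult:
  assumes "p \<in> ncT"
  shows "act (nc_mult (nc_var a) p) v = f a (act p v)"
proof -
  have f0: "f a 0 = 0" using f_scale[of a 0 0] by simp
  have fsum: "f a (\<Sum>x\<in>F. g x) = (\<Sum>x\<in>F. f a (g x))" if "finite F" for F :: "'a list set" and g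
    using that by induction (auto simp: f0 f_add)
  let ?F = "{w. p w \<noteq> 0}"
  have F: "finite ?F" using assms by (simp add: ncT_def)
  have *: "nc_mult (nc_var a) p w \<noteq> 0 \<Longrightarrow> w \<in> Cons a ` ?F" for w
    by (cases w) (auto simp: nc_var_mult_Nil nc_var_mult_Cons split: if_splits)
  have "act (nc_mult (nc_var a) p) v = (\<Sum>w \<in> Cons a ` ?F. scale (nc_mult (nc_var a) p w) (foldr f w v))"
    by (rule act_superset) (use F * in auto)
  also have "\<dots> = (\<Sum>w \<in> ?F. scale (p w) (f a (foldr f w v)))"
    by (subst sum.reindex) (auto simp: nc_var_mult_Cons)
  also have "\<dots> = f a (act p v)"
    unfolding act_def by (simp add: fsum[OF F] f_scale)
  finally show ?thesis .
qed

lemma act_var: "act (nc_var a) v = f a v"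
  using act_var_mult[OF ncT_one, of a v] by (simp add: nc_mult_one act_one)

lemma act_mult:
  assumes "p \<in> ncT" "q \<in> ncT"
  shows "act (nc_mult p q) v = act p (act q v)"
  using assms(1)
proof (induction rule: ncT_induct)
  case (const c)
  show ?case using assms(2) by (simp add: nc_smult_mult_left nc_one_mult act_smult act_one ncT_closed)
next
  case (add p p')
  then show ?case using assms(2) by (simp add: nc_mult_add_left act_add ncT_closed)
next
  case (var a p)
  then show ?case using assms(2) by (simp add: nc_mult_assoc act_var_mult ncT_closed)
qed

lemma act_comm:
  assumes "p \<in> ncT" "q \<in> ncT"
  shows "act (nc_comm p q) v = act p (act q v) - act q (act p v)"
  using assms by (simp add: nc_comm_def act_diff act_mult ncT_closed)

text \<open>A right multiple \<open>p a\<close> applies \<open>p\<close> to the vector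
  \<open>act a v\<close>, so the induction must range over all vectors.\<close>

lemma act_ideal:
  assumes G: "G \<subseteq> ncT" and zero: "\<And>g v. g \<in> G \<Longrightarrow> act g v = 0" and p: "p \<in> nc_ideal G"
  shows "act p v = 0"
  using p
proof (induction arbitrary: v)
  case (gen g)
  then show ?case by (rule zero)
next
  case zero
  show ?case by (rule act_zero)
next
  case (add p q)
  then show ?case using nc_ideal_subset_ncT[OF G] by (simp add: act_add)
next
  case (lmult a p)
  then show ?case using nc_ideal_subset_ncT[OF G] act_scale_right[of a 0 0] by (simp add: act_mult)
next
  case (rmult a p)
  then show ?case using nc_ideal_subset_ncT[OF G] by (simp add: act_mult)
qed

end

text \<open>Three modules are of this kind: \<open>H\<close>, the Weyl algebra under left
  multiplication by the images of \<open>x\<close>, \<open>y\<close>, \<open>d\<close>, and the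
  polynomials in two variables as a module over the Weyl algebra.\<close>

locale palg_rep = word_rep scale f
  for scale :: "complex \<Rightarrow> 'v::ab_group_add \<Rightarrow> 'v" and f :: "'a::presented \<Rightarrow> 'v \<Rightarrow> 'v" +
  assumes relators_act: "g \<in> relators \<Longrightarrow> act g v = 0"
begin

definition pact :: "'a palg \<Rightarrow> 'v \<Rightarrow> 'v" where
  "pact z = act (SOME p. p \<in> ncT \<and> z = abs_palg p)"

lemma pact_abs:
  assumes "p \<in> ncT"
  shows "pact (abs_palg p) v = act p v"
proof -
  define q where "q = (SOME q. q \<in> ncT \<and> abs_palg p = abs_palg q)"
  have "q \<in> ncT \<and> abs_palg p = abs_palg q"
    unfolding q_def by (rule someI[of _ p]) (use assms in simp)
  then have q: "q \<in> ncT" "nc_diff p q \<in> nc_ideal relators" using assms abs_palg_eq_iff[of p q] by auto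
  have "act (nc_diff p q) v = 0"
    by (rule act_ideal[OF relators_ncT relators_act q(2)])
  then have "act p v = act q v" using assms q by (simp add: act_diff)
  then show ?thesis by (simp add: pact_def q_def)
qed

lemma pact_add: "pact (x + y) v = pact x v + pact y v"
  by (rule abs_palg_cases[of x], rule abs_palg_cases[of y])
    (simp add: abs_palg_add[symmetric] pact_abs act_add ncT_closed)

lemma pact_mult: "pact (x * y) v = pact x (pact y v)"
  by (rule abs_palg_cases[of x], rule abs_palg_cases[of y])
    (simp add: abs_palg_mult[symmetric] pact_abs act_mult ncT_closed)

lemma pact_cst: "pact (cst c) v = scale c v"
  by (simp add: cst.abs_eq pact_abs act_smult act_one ncT_closed)

lemma pact_gen: "pact (gen a) v = f a v"
  by (simp add: gen.abs_eq pact_abs act_var ncT_closed)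

lemma pact_scale_right: "pact x (scale c v) = scale c (pact x v)"
  by (rule abs_palg_cases[of x]) (simp add: pact_abs act_scale_right)

lemma pact_0_right [simp]: "pact x 0 = 0"
  using pact_scale_right[of x 0 0] by simp

lemma pact_0 [simp]: "pact 0 v = 0"
  using pact_cst[of 0 v] by simp

lemma pact_1 [simp]: "pact 1 v = v"
  using pact_cst[of 1 v] by simp

lemma pact_uminus: "pact (- x) v = - pact x v"
  using pact_add[of x "- x" v] by (simp add: eq_neg_iff_add_eq_0 add.commute)

lemma pact_diff: "pact (x - y) v = pact x v - pact y v"
  using pact_add[of x "- y" v] by (simp add: pact_uminus)

lemma pact_sum: "pact (\<Sum>i\<in>F. g i) v = (\<Sum>i\<in>F. pact (g i) v)"
  by (induction F rule: infinite_finite_induct) (auto simp: pact_add)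

end

section \<open>The algebra on \<open>x\<close>, \<open>y\<close>, \<open>d\<close>\<close>


instantiation gen3 :: presented
begin

definition relators_gen3 :: "gen3 ncp set" where
  "relators_gen3 =
     { nc_comm (nc_var GX) (nc_var GY),
       nc_add (nc_comm (nc_var GD) (nc_var GX)) (nc_smult (1/3) (nc_var GY)),
       nc_add (nc_comm (nc_var GD) (nc_var GY)) (nc_smult (1/2) (nc_mult (nc_var GX) (nc_var GX))) }"

instance
  by standard (auto simp: relators_gen3_def intro: ncT_closed)

end

lemma I3_eq: "I3 = nc_ideal relators"
  by (simp add: I3_def relators_gen3_def)

instantiation gen4 :: presented
begin

definition relators_gen4 :: "gen4 ncp set" where
  "relators_gen4 =
     { nc_diff (nc_comm (nc_var WDX) (nc_var WX)) nc_one,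
       nc_diff (nc_comm (nc_var WDY) (nc_var WY)) nc_one,
       nc_comm (nc_var WDX) (nc_var WY),
       nc_comm (nc_var WDY) (nc_var WX),
       nc_comm (nc_var WX) (nc_var WY),
       nc_comm (nc_var WDX) (nc_var WDY) }"

instance
  by standard (auto simp: relators_gen4_def intro: ncT_closed)

end

lemma IWeyl_eq: "IWeyl = nc_ideal relators"
  by (simp add: IWeyl_def relators_gen4_def)

abbreviation "gX \<equiv> gen GX"
abbreviation "gY \<equiv> gen GY"
abbreviation "gD \<equiv> gen GD"

lemmas abs_palg_hom = abs_palg_comm abs_palg_add abs_palg_diff abs_palg_smult abs_palg_mult abs_palg_var
  abs_palg_one ncT_closed

lemma gX_gY: "gX * gY = gY * gX"
proof -
  have "abs_palg (nc_comm (nc_var GX) (nc_var GY)) = 0"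
    by (rule relator_zero) (simp add: relators_gen3_def)
  then show ?thesis by (simp add: abs_palg_hom)
qed

lemma gD_gX: "gD * gX = gX * gD - cst (1/3) * gY"
proof -
  have "abs_palg (nc_add (nc_comm (nc_var GD) (nc_var GX)) (nc_smult (1/3) (nc_var GY))) = 0"
    by (rule relator_zero) (simp add: relators_gen3_def)
  then show ?thesis by (simp add: abs_palg_hom algebra_simps)
qed

lemma gD_gY: "gD * gY = gY * gD - cst (1/2) * (gX * gX)"
proof -
  have "abs_palg (nc_add (nc_comm (nc_var GD) (nc_var GY)) (nc_smult (1/2) (nc_mult (nc_var GX) (nc_var GX)))) = 0"
    by (rule relator_zero) (simp add: relators_gen3_def)
  then show ?thesis by (simp add: abs_palg_hom algebra_simps)
qed

section \<open>Polynomials in \<open>gX\<close>, \<open>gY\<close> and the filtration by degree in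
  \<open>gD\<close>\<close>

inductive_set pol :: "gen3 palg set" where
  cst: "cst c \<in> pol"
| add: "a \<in> pol \<Longrightarrow> b \<in> pol \<Longrightarrow> a + b \<in> pol"
| X: "a \<in> pol \<Longrightarrow> gX * a \<in> pol"
| Y: "a \<in> pol \<Longrightarrow> gY * a \<in> pol"

lemma pol_0 [simp]: "0 \<in> pol"
  using pol.cst[of 0] by simp

lemma pol_1 [simp]: "1 \<in> pol"
  using pol.cst[of 1] by simp

lemma pol_cst_mult: "a \<in> pol \<Longrightarrow> cst c * a \<in> pol"
proof (induction rule: pol.induct)
  case (cst d)
  show ?case using pol.cst[of "c * d"] by (simp add: cst_mult)
qed (auto simp: distrib_left cst_left_commute[symmetric] intro: pol.intros)

lemma pol_uminus: "a \<in> pol \<Longrightarrow> - a \<in> pol"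
  using pol_cst_mult[of a "- 1"] by (simp add: cst_uminus)

lemma pol_diff: "a \<in> pol \<Longrightarrow> b \<in> pol \<Longrightarrow> a - b \<in> pol"
  using pol.add[of a "- b"] by (simp add: pol_uminus)

lemma pol_mult: "a \<in> pol \<Longrightarrow> b \<in> pol \<Longrightarrow> a * b \<in> pol"
  by (induction rule: pol.induct) (auto simp: distrib_right mult.assoc intro: pol.intros pol_cst_mult)

lemma pol_gX [simp]: "gX \<in> pol" and pol_gY [simp]: "gY \<in> pol"
  using pol.X[OF pol_1] pol.Y[OF pol_1] by auto

lemma pol_power: "a \<in> pol \<Longrightarrow> a ^ n \<in> pol"
  by (induction n) (auto intro: pol_mult)

lemma pol_gX_commute: "a \<in> pol \<Longrightarrow> a * gX = gX * a"
proof (induction rule: pol.induct)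
  case (Y a)
  then show ?case by (metis gX_gY mult.assoc)
qed (auto simp: algebra_simps cst_commute)

lemma pol_gY_commute: "a \<in> pol \<Longrightarrow> a * gY = gY * a"
proof (induction rule: pol.induct)
  case (X a)
  then show ?case by (metis gX_gY mult.assoc)
qed (auto simp: algebra_simps cst_commute)

text \<open>The commutator with \<open>gD\<close> is a derivation that sends \<open>gX\<close> and
  \<open>gY\<close> into \<open>pol\<close>.\<close>

lemma gD_pol_comm: "a \<in> pol \<Longrightarrow> gD * a - a * gD \<in> pol"
proof (induction rule: pol.induct)
  case (cst c)
  then show ?case by (simp add: cst_commute)
next
  case (add a b)
  then have "(gD * a - a * gD) + (gD * b - b * gD) \<in> pol" by (intro pol.add)
  then show ?case by (simp add: algebra_simps)
next
  case (X a)
  have "gD * (gX * a) - gX * a * gD = gX * (gD * a - a * gD) - cst (1/3) * (gY * a)"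
    unfolding mult.assoc[symmetric] gD_gX by (simp add: algebra_simps)
  then show ?case using X by (auto intro: pol_diff pol.intros pol_cst_mult)
next
  case (Y a)
  have "gD * (gY * a) - gY * a * gD = gY * (gD * a - a * gD) - cst (1/2) * (gX * (gX * a))"
    unfolding mult.assoc[symmetric] gD_gY by (simp add: algebra_simps)
  then show ?case using Y by (auto intro: pol_diff pol.intros pol_cst_mult)
qed

text \<open>The coefficients are not claimed to be unique; independence of the monomials is detected
  later through their actions.\<close>

lemma pol_eq_sum:
  assumes "a \<in> pol"
  obtains F c where "finite F" "a = (\<Sum>(i, j) \<in> F. cst (c i j) * (gX ^ i * gY ^ j))"
proof -
  have "\<exists>F c. finite F \<and> a = (\<Sum>(i, j) \<in> F. cst (c i j) * (gX ^ i * gY ^ j))"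
    using assms
  proof (induction rule: pol.induct)
    case (cst d)
    show ?case by (rule exI[of _ "{(0, 0)}"], rule exI[of _ "\<lambda>_ _. d"]) simp
  next
    case (add a b)
    then obtain F c G d where *: "finite F" "a = (\<Sum>(i, j) \<in> F. cst (c i j) * (gX ^ i * gY ^ j))"
      "finite G" "b = (\<Sum>(i, j) \<in> G. cst (d i j) * (gX ^ i * gY ^ j))" by auto
    have "a = (\<Sum>(i, j) \<in> F \<union> G. cst (if (i, j) \<in> F then c i j else 0) * (gX ^ i * gY ^ j))"
      unfolding *(2) by (rule sum.mono_neutral_cong_left) (use * in auto)
    moreover have "b = (\<Sum>(i, j) \<in> F \<union> G. cst (if (i, j) \<in> G then d i j else 0) * (gX ^ i * gY ^ j))"
      unfolding *(4) by (rule sum.mono_neutral_cong_left) (use * in auto)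
    ultimately have "a + b = (\<Sum>(i, j) \<in> F \<union> G.
        cst ((if (i, j) \<in> F then c i j else 0) + (if (i, j) \<in> G then d i j else 0)) * (gX ^ i * gY ^ j))"
      by (simp only: sum.distrib[symmetric] case_prod_unfold cst_add distrib_right)
    then show ?case using *(1,3) by (intro exI[of _ "F \<union> G"]) auto
  next
    case (X a)
    then obtain F c where *: "finite F" "a = (\<Sum>(i, j) \<in> F. cst (c i j) * (gX ^ i * gY ^ j))" by auto
    have "gX * a = (\<Sum>(i, j) \<in> (\<lambda>(i, j). (Suc i, j)) ` F. cst (c (i - 1) j) * (gX ^ i * gY ^ j))"
      unfolding *(2) sum_distrib_left
      by (subst sum.reindex) (auto simp: inj_on_def cst_left_commute mult.assoc intro!: sum.cong)
    then show ?case using *(1)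
      by (intro exI[of _ "(\<lambda>(i, j). (Suc i, j)) ` F"] exI[of _ "\<lambda>i. c (i - 1)"]) auto
  next
    case (Y a)
    then obtain F c where *: "finite F" "a = (\<Sum>(i, j) \<in> F. cst (c i j) * (gX ^ i * gY ^ j))" by auto
    have "gY * (gX ^ i * gY ^ j) = gX ^ i * gY ^ Suc j" for i j
      using pol_gY_commute[OF pol_power[OF pol_gX], of i] by (simp add: mult.assoc[symmetric])
    then have "gY * a = (\<Sum>(i, j) \<in> (\<lambda>(i, j). (i, Suc j)) ` F. cst (c i (j - 1)) * (gX ^ i * gY ^ j))"
      unfolding *(2) sum_distrib_left
      by (subst sum.reindex) (auto simp: inj_on_def cst_left_commute simp del: power_Suc intro!: sum.cong)
    then show ?case using *(1)
      by (intro exI[of _ "(\<lambda>(i, j). (i, Suc j)) ` F"] exI[of _ "\<lambda>i j. c i (j - 1)"]) auto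
  qed
  then show ?thesis using that by blast
qed

lemma gY_power_mult_sum:
  "gY ^ n * (\<Sum>(i, j) \<in> F. cst (c i j) * (gX ^ i * gY ^ j)) = (\<Sum>(i, j) \<in> F. cst (c i j) * (gX ^ i * gY ^ (n + j)))"
proof -
  have "gX ^ i * gY ^ n = gY ^ n * gX ^ i" for i
    by (induction n) (auto simp: mult.assoc[symmetric] pol_gY_commute[OF pol_power[OF pol_gX]],
        simp add: mult.assoc)
  then have "gY ^ n * (gX ^ i * gY ^ j) = gX ^ i * gY ^ (n + j)" for i j
    by (simp add: mult.assoc[symmetric] power_add)
  then show ?thesis unfolding sum_distrib_left by (simp add: cst_left_commute case_prod_unfold)
qed

text \<open>The degree in \<open>gD\<close> is less than \<open>N\<close>, so \<open>dfilt 0\<close>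
  is zero and elements of \<open>dfilt (Suc N)\<close> lead with \<open>gD ^ N\<close>. The
  coefficients need not be determined by the element.\<close>

definition dfilt :: "nat \<Rightarrow> gen3 palg set" where
  "dfilt N = {z. \<exists>a. (\<forall>k. a k \<in> pol) \<and> z = (\<Sum>k<N. a k * gD ^ k)}"

lemma dfilt_0: "dfilt 0 = {0}"
  by (auto simp: dfilt_def intro!: exI[of _ "\<lambda>_. 0"])

lemma dfilt_Suc: "z \<in> dfilt (Suc N) \<longleftrightarrow> (\<exists>a\<in>pol. \<exists>l\<in>dfilt N. z = a * gD ^ N + l)"
proof
  assume "z \<in> dfilt (Suc N)"
  then obtain a where "\<forall>k. a k \<in> pol" "z = (\<Sum>k<Suc N. a k * gD ^ k)" by (auto simp: dfilt_def)
  then show "\<exists>a\<in>pol. \<exists>l\<in>dfilt N. z = a * gD ^ N + l"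
    by (intro bexI[of _ "a N"] bexI[of _ "\<Sum>k<N. a k * gD ^ k"]) (auto simp: dfilt_def add.commute)
next
  assume "\<exists>a\<in>pol. \<exists>l\<in>dfilt N. z = a * gD ^ N + l"
  then obtain a b where *: "a \<in> pol" "\<forall>k. b k \<in> pol" "z = a * gD ^ N + (\<Sum>k<N. b k * gD ^ k)"
    by (auto simp: dfilt_def)
  then show "z \<in> dfilt (Suc N)"
    unfolding dfilt_def by (auto intro!: exI[of _ "b(N := a)"] simp: add.commute)
qed

lemma dfilt_zero: "0 \<in> dfilt N"
  by (auto simp: dfilt_def intro!: exI[of _ "\<lambda>_. 0"])

lemma dfilt_add: "z \<in> dfilt N \<Longrightarrow> w \<in> dfilt N \<Longrightarrow> z + w \<in> dfilt N"
proof (induction N arbitrary: z w)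
  case (Suc N)
  then obtain a l b m where "a \<in> pol" "b \<in> pol" "l \<in> dfilt N" "m \<in> dfilt N"
    "z = a * gD ^ N + l" "w = b * gD ^ N + m" by (auto simp: dfilt_Suc)
  then show ?case using Suc.IH[of l m] unfolding dfilt_Suc
    by (intro bexI[of _ "a + b"] bexI[of _ "l + m"]) (auto simp: algebra_simps intro: pol.add)
qed (simp add: dfilt_0)

lemma dfilt_pol_mult: "b \<in> pol \<Longrightarrow> z \<in> dfilt N \<Longrightarrow> b * z \<in> dfilt N"
proof (induction N arbitrary: z)
  case (Suc N)
  then obtain a l where *: "a \<in> pol" "l \<in> dfilt N" "z = a * gD ^ N + l" by (auto simp: dfilt_Suc)
  have "b * z = b * a * gD ^ N + b * l" unfolding *(3) by (simp add: distrib_left mult.assoc)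
  moreover have "b * a \<in> pol" "b * l \<in> dfilt N" using Suc * by (auto intro: pol_mult)
  ultimately show ?case unfolding dfilt_Suc by blast
qed (simp add: dfilt_0)

lemma dfilt_mono: "z \<in> dfilt N \<Longrightarrow> N \<le> M \<Longrightarrow> z \<in> dfilt M"
proof (induction M rule: nat_induct)
  case (Suc M)
  show ?case
  proof (cases "N = Suc M")
    case False
    then have "z \<in> dfilt M" using Suc by auto
    then show ?thesis unfolding dfilt_Suc by (intro bexI[of _ 0] bexI[of _ z]) auto
  qed (use Suc in auto)
qed auto

lemma dfilt_monomial: "a \<in> pol \<Longrightarrow> a * gD ^ N \<in> dfilt (Suc N)"
  unfolding dfilt_Suc using dfilt_zero by (intro bexI[of _ a] bexI[of _ 0]) auto

lemma gD_dfilt: "z \<in> dfilt N \<Longrightarrow> gD * z \<in> dfilt (Suc N)"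
proof (induction N arbitrary: z)
  case 0
  then show ?case by (simp add: dfilt_0 dfilt_zero)
next
  case (Suc N)
  then obtain a l where *: "a \<in> pol" "l \<in> dfilt N" "z = a * gD ^ N + l" by (auto simp: dfilt_Suc)
  have "gD * z = a * gD ^ Suc N + ((gD * a - a * gD) * gD ^ N + gD * l)"
    unfolding *(3) by (simp add: algebra_simps)
  moreover have "(gD * a - a * gD) * gD ^ N + gD * l \<in> dfilt (Suc N)"
    using Suc.IH[OF *(2)] gD_pol_comm[OF *(1)] by (intro dfilt_add dfilt_monomial)
  ultimately show ?case using *(1) by (subst dfilt_Suc) blast
qed

lemma dfilt_exhaust: "\<exists>N. z \<in> dfilt N"
proof (induction z rule: palg_induct)
  case (cst c)
  show ?case using dfilt_monomial[OF pol.cst[of c], of 0] by auto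
next
  case (add x y)
  then obtain N M where "x \<in> dfilt N" "y \<in> dfilt M" by auto
  then have "x + y \<in> dfilt (max N M)" by (intro dfilt_add) (auto intro: dfilt_mono)
  then show ?case ..
next
  case (gen g x)
  then obtain N where "x \<in> dfilt N" ..
  then show ?case
    by (cases g) (use gD_dfilt dfilt_pol_mult[OF pol_gX] dfilt_pol_mult[OF pol_gY] in blast)+
qed

text \<open>Each of the \<open>Suc N\<close> factors \<open>gD\<close> that passes \<open>gX\<close>
  contributes \<open>- gY / 3\<close>. Moving \<open>gD\<close> past such a \<open>gY\<close> costs
  another degree, and the resulting \<open>gX * gX\<close> disappears into \<open>l\<close>.\<close>

lemma gD_power_gX:
  "\<exists>l\<in>dfilt N. gD ^ Suc N * gX = gX * gD ^ Suc N - cst (of_nat (Suc N) / 3) * gY * gD ^ N + l"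
proof (induction N)
  case 0
  then show ?case by (simp add: dfilt_0 gD_gX)
next
  case (Suc N)
  then obtain l where l: "l \<in> dfilt N"
    "gD ^ Suc N * gX = gX * gD ^ Suc N - cst (of_nat (Suc N) / 3) * gY * gD ^ N + l" by auto
  define c :: complex where "c = of_nat (Suc N) / 3"
  have c: "of_nat (Suc (Suc N)) / 3 = c + 1 / 3" by (simp add: c_def field_simps)
  have "gD ^ Suc (Suc N) * gX = gD * (gX * gD ^ Suc N - cst c * gY * gD ^ N + l)"
    unfolding c_def l(2)[symmetric] by (simp add: mult.assoc)
  also have "\<dots> = (gD * gX) * gD ^ Suc N - cst c * ((gD * gY) * gD ^ N) + gD * l"
    by (simp add: algebra_simps cst_left_commute)
  also have "\<dots> = gX * gD ^ Suc (Suc N) - cst (c + 1 / 3) * gY * gD ^ Suc N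
      + (cst c * (cst (1/2) * (gX * gX)) * gD ^ N + gD * l)"
    unfolding gD_gX gD_gY by (simp add: algebra_simps cst_add)
  finally show ?case unfolding c
    using l(1) by (intro bexI) (auto intro!: dfilt_add gD_dfilt dfilt_monomial pol_cst_mult pol.intros)
qed

text \<open>Coefficients in \<open>pol\<close> commute with \<open>gX\<close>, so only powers of
  \<open>gD\<close> contribute, each losing a degree. This controls the lower terms in
  \<open>ideal_leading_coeff\<close>.\<close>

lemma dfilt_gX_comm: "z \<in> dfilt (Suc N) \<Longrightarrow> z * gX - gX * z \<in> dfilt N"
proof (induction N arbitrary: z)
  case 0
  then show ?case by (auto simp: dfilt_Suc dfilt_0 pol_gX_commute)
next
  case (Suc N)
  then obtain a m where *: "a \<in> pol" "m \<in> dfilt (Suc N)" "z = a * gD ^ Suc N + m" by (auto simp: dfilt_Suc[of _ "Suc N"])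
  obtain l where l: "l \<in> dfilt N"
    "gD ^ Suc N * gX = gX * gD ^ Suc N - cst (of_nat (Suc N) / 3) * gY * gD ^ N + l"
    using gD_power_gX by blast
  have "z * gX - gX * z = a * (gD ^ Suc N * gX) - (gX * a) * gD ^ Suc N + (m * gX - gX * m)"
    unfolding *(3) by (simp add: algebra_simps)
  also have "\<dots> = - (a * (cst (of_nat (Suc N) / 3) * gY)) * gD ^ N + a * l + (m * gX - gX * m)"
    unfolding l(2) pol_gX_commute[OF *(1), symmetric] by (simp add: algebra_simps)
  also have "\<dots> \<in> dfilt (Suc N)"
  proof -
    have "a * l \<in> dfilt (Suc N)"
      by (rule dfilt_mono[OF dfilt_pol_mult[OF *(1) l(1)]]) simp
    moreover have "m * gX - gX * m \<in> dfilt (Suc N)"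
      by (rule dfilt_mono[OF Suc.IH[OF *(2)]]) simp
    moreover have "- (a * (cst (of_nat (Suc N) / 3) * gY)) \<in> pol"
      by (intro pol_uminus pol_mult pol.cst pol_gY *(1))
    ultimately show ?thesis by (intro dfilt_add dfilt_monomial)
  qed
  finally show ?case .
qed

text \<open>Commuting with \<open>gX\<close> lowers the degree in \<open>gD\<close> by one and multiplies the leading coefficient by a
  nonzero multiple of \<open>gY\<close>, so a two-sided ideal reaches degree \<open>0\<close> from any of its elements.\<close>

lemma ideal_leading_coeff:
  assumes diff: "\<And>x y. K x \<Longrightarrow> K y \<Longrightarrow> K (x - y)"
    and left: "\<And>w x. K x \<Longrightarrow> K (w * x)" and right: "\<And>w x. K x \<Longrightarrow> K (x * w)"
    and "a \<in> pol" "l \<in> dfilt N" "K (a * gD ^ N + l)"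
  shows "K (gY ^ N * a)"
  using assms(4-6)
proof (induction N arbitrary: a l)
  case 0
  then show ?case by (simp add: dfilt_0)
next
  case (Suc N)
  obtain m where m: "m \<in> dfilt N"
    "gD ^ Suc N * gX = gX * gD ^ Suc N - cst (of_nat (Suc N) / 3) * gY * gD ^ N + m"
    using gD_power_gX by blast
  define z where "z = a * gD ^ Suc N + l"
  define c :: complex where "c = of_nat (Suc N) / 3"
  have c: "c \<noteq> 0" by (simp add: c_def del: of_nat_Suc)
  have "z * gX - gX * z = a * (gD ^ Suc N * gX) - (gX * a) * gD ^ Suc N + (l * gX - gX * l)"
    unfolding z_def by (simp add: algebra_simps)
  also have "\<dots> = (- (a * (cst c * gY))) * gD ^ N + (a * m + (l * gX - gX * l))"
    unfolding m(2) pol_gX_commute[OF \<open>a \<in> pol\<close>, symmetric] c_def by (simp add: algebra_simps)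
  also have "- (a * (cst c * gY)) = cst (- c) * (gY * a)"
    using pol_gY_commute[OF \<open>a \<in> pol\<close>] by (simp add: cst_left_commute cst_uminus)
  finally have eq: "z * gX - gX * z = cst (- c) * (gY * a) * gD ^ N + (a * m + (l * gX - gX * l))" .
  have "K (z * gX - gX * z)" using Suc.prems(3) unfolding z_def by (intro diff left right)
  then have "K (gY ^ N * (cst (- c) * (gY * a)))"
    unfolding eq using Suc.prems m(1)
    by (intro Suc.IH) (auto intro: pol_cst_mult pol.intros dfilt_add dfilt_pol_mult dfilt_gX_comm)
  \<comment> \<open>The integer \<open>Suc N\<close> is invertible in the complex numbers, so the
    scalar factor can be undone.\<close>
  then have "K (cst (- inverse c) * (gY ^ N * (cst (- c) * (gY * a))))" by (rule left)
  also have "cst (- inverse c) * (gY ^ N * (cst (- c) * (gY * a))) = cst (- inverse c * - c) * (gY ^ N * (gY * a))"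
    by (subst cst_left_commute) (simp only: cst_mult mult.assoc)
  also have "\<dots> = gY ^ Suc N * a"
    using c by (simp add: mult.assoc[symmetric] power_commutes)
  finally show ?case .
qed

text \<open>Leading coefficients are removed one at a time. The hypothesis \<open>pol\<close>
  includes the cancellation of \<open>gY ^ n\<close>, to be verified in a concrete module, since
  \<open>gY\<close> might a priori be a zero divisor in the quotient.\<close>

lemma ideal_trivial:
  assumes diff: "\<And>x y. K x \<Longrightarrow> K y \<Longrightarrow> K (x - y)"
    and left: "\<And>w x. K x \<Longrightarrow> K (w * x)" and right: "\<And>w x. K x \<Longrightarrow> K (x * w)"
    and pol: "\<And>a n. a \<in> pol \<Longrightarrow> K (gY ^ n * a) \<Longrightarrow> a = 0"
    and "K z"
  shows "z = 0"
proof -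
  obtain N where "z \<in> dfilt N" using dfilt_exhaust by blast
  then show ?thesis using \<open>K z\<close>
  proof (induction N)
    case 0
    then show ?case by (simp add: dfilt_0)
  next
    case (Suc N)
    then obtain a l where *: "a \<in> pol" "l \<in> dfilt N" "z = a * gD ^ N + l" by (auto simp: dfilt_Suc)
    then have "a = 0" using Suc.prems ideal_leading_coeff[OF diff left right, of a l N] pol by blast
    then show ?case using * Suc by simp
  qed
qed

text \<open>All terms with a positive power of \<open>gD\<close> are left multiples of
  \<open>gD\<close>; modulo the left ideal of \<open>gD\<close> only a polynomial survives.\<close>

lemma palg_eq_pol_plus_gD:
  obtains a w where "a \<in> pol" "z = a + w * gD"
proof -
  obtain N where "z \<in> dfilt N" using dfilt_exhaust by blast
  then have "\<exists>a\<in>pol. \<exists>w. z = a + w * gD"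
  proof (induction N arbitrary: z)
    case 0
    then show ?case by (intro bexI[of _ 0] exI[of _ 0]) (auto simp: dfilt_0)
  next
    case (Suc N)
    then obtain a l where *: "a \<in> pol" "l \<in> dfilt N" "z = a * gD ^ N + l" by (auto simp: dfilt_Suc)
    with Suc.IH obtain b w where bw: "b \<in> pol" "l = b + w * gD" by blast
    show ?case
    proof (cases N)
      case 0
      then show ?thesis using * bw by (intro bexI[of _ "a + b"] exI[of _ w]) (auto intro: pol.add)
    next
      case (Suc M)
      have "z = b + (a * gD ^ M + w) * gD"
        unfolding *(3) bw(2) Suc by (simp add: algebra_simps power_commutes)
      then show ?thesis using bw(1) by blast
    qed
  qed
  then show ?thesis using that by blast
qed

section \<open>The action on \<open>H\<close>\<close>


lemma Hol_0: "(\<lambda>z. 0) \<in> Hol"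
  by (simp add: Hol_def)

lemma Hol_add: "f \<in> Hol \<Longrightarrow> g \<in> Hol \<Longrightarrow> (\<lambda>z. f z + g z) \<in> Hol"
  by (auto simp: Hol_def intro: holomorphic_intros)

lemma Hol_mult: "g holomorphic_on uhp \<Longrightarrow> f \<in> Hol \<Longrightarrow> (\<lambda>z. g z * f z) \<in> Hol"
  by (auto simp: Hol_def intro: holomorphic_intros)

lemma Hol_Dk: "f \<in> Hol \<Longrightarrow> Dk k f \<in> Hol"
proof -
  assume f: "f \<in> Hol"
  have "(\<lambda>z. deriv f z / (2 * of_real pi * \<i>) - of_real k / 12 * E2 z * f z) holomorphic_on uhp"
    using f by (intro holomorphic_intros holomorphic_deriv E2_holomorphic open_uhp) (auto simp: Hol_def)
  then have "Dk k f holomorphic_on uhp"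
    by (rule holomorphic_transform) (simp add: Dk_def)
  then show ?thesis by (simp add: Hol_def Dk_def)
qed

lemma Dk_zero: "Dk k (\<lambda>z. 0) = (\<lambda>z. 0)"
  by (simp add: Dk_def fun_eq_iff)

lemma Dk_add: "f \<in> Hol \<Longrightarrow> g \<in> Hol \<Longrightarrow> Dk k (\<lambda>z. f z + g z) = (\<lambda>z. Dk k f z + Dk k g z)"
proof
  fix z assume f: "f \<in> Hol" "g \<in> Hol"
  have "deriv (\<lambda>z. f z + g z) z = deriv f z + deriv g z" if "z \<in> uhp"
    using f that by (intro deriv_add) (auto simp: Hol_def intro: holomorphic_on_imp_differentiable_at[OF _ open_uhp])
  then show "Dk k (\<lambda>z. f z + g z) z = Dk k f z + Dk k g z"
    by (simp add: Dk_def algebra_simps add_divide_distrib)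
qed

text \<open>The \<open>E2\<close> term is additive in the weight, so it can be shared between the
  two summands of the product rule.\<close>

lemma Dk_mult:
  assumes g: "g holomorphic_on uhp" and f: "f \<in> Hol" and z: "z \<in> uhp"
  shows "Dk (k + l) (\<lambda>z. g z * f z) z
    = (deriv g z / (2 * of_real pi * \<i>) - of_real l / 12 * E2 z * g z) * f z + g z * Dk k f z"
proof -
  have "deriv (\<lambda>z. g z * f z) z = g z * deriv f z + deriv g z * f z"
    using g f z by (intro deriv_mult) (auto simp: Hol_def intro: holomorphic_on_imp_differentiable_at[OF _ open_uhp])
  then show ?thesis using z by (simp add: Dk_def algebra_simps add_divide_distrib)
qed

lemma Dk_scale:
  assumes "f \<in> Hol"
  shows "Dk k (\<lambda>z. c * f z) = (\<lambda>z. c * Dk k f z)"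
proof
  fix z
  show "Dk k (\<lambda>z. c * f z) z = c * Dk k f z"
    using Dk_mult[of "\<lambda>_. c" f z k 0] assms by (cases "z \<in> uhp") (auto simp: Dk_def)
qed

text \<open>In weight 4 the correction \<open>4 / 12 * E2 * E4\<close> cancels the \<open>E2\<close>
  term of Ramanujan's identity and leaves \<open>- E6 / 3\<close>; weight 6 does the same for
  \<open>E6\<close>.\<close>

lemma Dk_E4_mult:
  assumes "f \<in> Hol" "z \<in> uhp"
  shows "Dk (k + 4) (\<lambda>z. E4 z * f z) z = E4 z * Dk k f z - E6 z * f z / 3"
  unfolding Dk_mult[OF E4_holomorphic assms] ramanujan_E4[OF assms(2)] by (simp add: field_simps)

lemma Dk_E6_mult:
  assumes "f \<in> Hol" "z \<in> uhp"
  shows "Dk (k + 6) (\<lambda>z. E6 z * f z) z = E6 z * Dk k f z - E4 z * (E4 z * f z) / 2"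
  unfolding Dk_mult[OF E6_holomorphic assms] ramanujan_E6[OF assms(2)] by (simp add: field_simps power2_eq_square)

lemma Hspace_Hol: "F \<in> Hspace \<Longrightarrow> F n \<in> Hol"
  by (simp add: Hspace_def)

lemma Hspace_outside: "F \<in> Hspace \<Longrightarrow> z \<notin> uhp \<Longrightarrow> F n z = 0"
  using Hspace_Hol[of F n] by (simp add: Hol_def)

lemma Hspace_shiftI:
  assumes F: "F \<in> Hspace" and "\<And>n f. f \<in> Hol \<Longrightarrow> T n f \<in> Hol" and zero: "\<And>n. T n (\<lambda>z. 0) = (\<lambda>z. 0)"
  shows "(\<lambda>m. T m (F (m - i))) \<in> Hspace"
proof -
  have "{n. T n (F (n - i)) \<noteq> (\<lambda>z. 0)} \<subseteq> (\<lambda>n. n + i) ` {n. F n \<noteq> (\<lambda>z. 0)}"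
  proof
    fix n assume "n \<in> {n. T n (F (n - i)) \<noteq> (\<lambda>z. 0)}"
    then have "F (n - i) \<noteq> (\<lambda>z. 0)" using zero by auto
    then show "n \<in> (\<lambda>n. n + i) ` {n. F n \<noteq> (\<lambda>z. 0)}" by (intro image_eqI[of _ _ "n - i"]) auto
  qed
  then have "finite {n. T n (F (n - i)) \<noteq> (\<lambda>z. 0)}"
    using F by (auto simp: Hspace_def intro: finite_subset)
  then show ?thesis using assms by (simp add: Hspace_def)
qed

lemma Hspace_delta: "F \<in> Hspace \<Longrightarrow> delta_op F \<in> Hspace"
  unfolding delta_op_def using Hspace_shiftI[of F "\<lambda>m. Dk (m - 2)" 2] by (auto intro: Hol_Dk simp: Dk_zero)

lemma Hspace_e4: "F \<in> Hspace \<Longrightarrow> e4_op F \<in> Hspace"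
  unfolding e4_op_def using Hspace_shiftI[of F "\<lambda>m f z. E4 z * f z" 4] by (auto intro: Hol_mult E4_holomorphic)

lemma Hspace_e6: "F \<in> Hspace \<Longrightarrow> e6_op F \<in> Hspace"
  unfolding e6_op_def using Hspace_shiftI[of F "\<lambda>m f z. E6 z * f z" 6] by (auto intro: Hol_mult E6_holomorphic)

lemma Hspace_zero: "hzero \<in> Hspace"
  by (simp add: Hspace_def hzero_def Hol_0)

lemma Hspace_add: "F \<in> Hspace \<Longrightarrow> G \<in> Hspace \<Longrightarrow> hadd F G \<in> Hspace"
  unfolding Hspace_def hadd_def mem_Collect_eq
  by (intro conjI allI Hol_add, simp, simp, rule finite_subset[of _ "{n. F n \<noteq> (\<lambda>z. 0)} \<union> {n. G n \<noteq> (\<lambda>z. 0)}"])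
    auto

lemma Hspace_smult: "F \<in> Hspace \<Longrightarrow> hsmult c F \<in> Hspace"
  unfolding Hspace_def hsmult_def mem_Collect_eq
  by (intro conjI allI Hol_mult, simp, simp, rule finite_subset[of _ "{n. F n \<noteq> (\<lambda>z. 0)}"]) auto

text \<open>As a type of its own, \<open>H\<close> becomes an abelian group without membership
  conditions, the form in which modules are treated above.\<close>

typedef hsp = Hspace
  using Hspace_zero by auto

setup_lifting type_definition_hsp

instantiation hsp :: ab_group_add
begin

lift_definition zero_hsp :: hsp is hzero by (rule Hspace_zero)
lift_definition plus_hsp :: "hsp \<Rightarrow> hsp \<Rightarrow> hsp" is hadd by (rule Hspace_add)
lift_definition uminus_hsp :: "hsp \<Rightarrow> hsp" is "hsmult (- 1)" by (rule Hspace_smult)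
lift_definition minus_hsp :: "hsp \<Rightarrow> hsp \<Rightarrow> hsp" is "\<lambda>F G. hadd F (hsmult (- 1) G)"
  by (intro Hspace_add Hspace_smult)

instance
  by standard (transfer; simp add: hadd_def hsmult_def hzero_def algebra_simps)+

end

lift_definition hscale :: "complex \<Rightarrow> hsp \<Rightarrow> hsp" is hsmult by (rule Hspace_smult)

lift_definition delta_hsp :: "hsp \<Rightarrow> hsp" is delta_op by (rule Hspace_delta)
lift_definition e4_hsp :: "hsp \<Rightarrow> hsp" is e4_op by (rule Hspace_e4)
lift_definition e6_hsp :: "hsp \<Rightarrow> hsp" is e6_op by (rule Hspace_e6)

fun gen3_op :: "gen3 \<Rightarrow> hsp \<Rightarrow> hsp" where
  "gen3_op GX = e4_hsp"
| "gen3_op GY = e6_hsp"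
| "gen3_op GD = delta_hsp"

interpretation H: word_rep hscale gen3_op
proof
  show "hscale a (x + y) = hscale a x + hscale a y" for a x y
    by transfer (simp add: hsmult_def hadd_def algebra_simps)
  show "hscale (a + b) x = hscale a x + hscale b x" for a b x
    by transfer (simp add: hsmult_def hadd_def algebra_simps)
  show "hscale a (hscale b x) = hscale (a * b) x" for a b x
    by transfer (simp add: hsmult_def algebra_simps)
  show "hscale 1 x = x" for x
    by transfer (simp add: hsmult_def)
  show "gen3_op g (u + v) = gen3_op g u + gen3_op g v" for g u v
  proof (cases g; simp; transfer)
    fix F G assume "F \<in> Hspace" "G \<in> Hspace"
    note FG = this Hspace_add[OF this]
    show "e4_op (hadd F G) = hadd (e4_op F) (e4_op G)"
      using FG by (simp add: e4_op_def) (simp add: hadd_def algebra_simps)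
    show "e6_op (hadd F G) = hadd (e6_op F) (e6_op G)"
      using FG by (simp add: e6_op_def) (simp add: hadd_def algebra_simps)
    show "delta_op (hadd F G) = hadd (delta_op F) (delta_op G)"
      using FG by (simp add: delta_op_def) (simp add: hadd_def Dk_add Hspace_Hol)
  qed
  show "gen3_op g (hscale c v) = hscale c (gen3_op g v)" for g c v
  proof (cases g; simp; transfer)
    fix F c assume "F \<in> Hspace"
    note F = this Hspace_smult[OF this]
    show "e4_op (hsmult c F) = hsmult c (e4_op F)"
      using F by (simp add: e4_op_def) (simp add: hsmult_def algebra_simps)
    show "e6_op (hsmult c F) = hsmult c (e6_op F)"
      using F by (simp add: e6_op_def) (simp add: hsmult_def algebra_simps)
    show "delta_op (hsmult c F) = hsmult c (delta_op F)"
      using F by (simp add: delta_op_def) (simp add: hsmult_def Dk_scale Hspace_Hol)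
  qed
qed

lemma e4_e6_commute: "F \<in> Hspace \<Longrightarrow> e4_op (e6_op F) = e6_op (e4_op F)"
  using Hspace_e4[of F] Hspace_e6[of F]
  by (simp add: e4_op_def e6_op_def fun_eq_iff algebra_simps)

lemma delta_e4:
  assumes F: "F \<in> Hspace"
  shows "delta_op (e4_op F) = hadd (e4_op (delta_op F)) (hsmult (- 1 / 3) (e6_op F))"
proof (intro ext)
  fix m z
  have "Dk (m - 2) (\<lambda>z. E4 z * F (m - 2 - 4) z) z = E4 z * Dk (m - 4 - 2) (F (m - 4 - 2)) z + (- 1 / 3) * (E6 z * F (m - 6) z)"
    \<comment> \<open>Index and weight are both \<open>m - 6\<close>, as \<open>delta_op\<close>
      applies \<open>Dk n\<close> to the component of weight \<open>n\<close>; after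
      \<open>E4\<close> the weight is \<open>m - 6 + 4 = m - 2\<close>.\<close>
    using Dk_E4_mult[OF Hspace_Hol[OF F], of z "m - 6" "m - 6"]
    by (cases "z \<in> uhp") (auto simp: Dk_def Hspace_outside[OF F])
  then show "delta_op (e4_op F) m z = hadd (e4_op (delta_op F)) (hsmult (- 1 / 3) (e6_op F)) m z"
    using F Hspace_e4[OF F] Hspace_delta[OF F] by (simp add: delta_op_def e4_op_def e6_op_def hadd_def hsmult_def)
qed

lemma delta_e6:
  assumes F: "F \<in> Hspace"
  shows "delta_op (e6_op F) = hadd (e6_op (delta_op F)) (hsmult (- 1 / 2) (e4_op (e4_op F)))"
proof (intro ext)
  fix m z
  have "Dk (m - 2) (\<lambda>z. E6 z * F (m - 2 - 6) z) z = E6 z * Dk (m - 6 - 2) (F (m - 6 - 2)) z + (- 1 / 2) * (E4 z * (E4 z * F (m - 4 - 4) z))"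
    using Dk_E6_mult[OF Hspace_Hol[OF F], of z "m - 8" "m - 8"]
    by (cases "z \<in> uhp") (auto simp: Dk_def Hspace_outside[OF F])
  then show "delta_op (e6_op F) m z = hadd (e6_op (delta_op F)) (hsmult (- 1 / 2) (e4_op (e4_op F))) m z"
    using F Hspace_e4[OF F] Hspace_e6[OF F] Hspace_delta[OF F]
    by (simp add: delta_op_def e4_op_def e6_op_def hadd_def hsmult_def)
qed

interpretation H: palg_rep hscale gen3_op
proof
  fix g v assume "g \<in> (relators :: gen3 ncp set)"
  moreover have "e4_hsp (e6_hsp v) = e6_hsp (e4_hsp v)"
    by transfer (rule e4_e6_commute)
  moreover have "delta_hsp (e4_hsp v) = e4_hsp (delta_hsp v) + hscale (- 1 / 3) (e6_hsp v)"
    by transfer (rule delta_e4)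
  moreover have "delta_hsp (e6_hsp v) = e6_hsp (delta_hsp v) + hscale (- 1 / 2) (e4_hsp (e4_hsp v))"
    by transfer (rule delta_e6)
  moreover have "hscale (- c) w + hscale c w = 0" for c w
    by (simp add: H.scale_left_distrib[symmetric])
  ultimately show "H.act g v = 0"
    by (auto simp: relators_gen3_def H.act_add H.act_comm H.act_mult H.act_smult H.act_var ncT_closed)
qed

section \<open>The operator algebra and its modules\<close>


definition op_of :: "gen3 palg \<Rightarrow> hop" where
  "op_of z F = (if F \<in> Hspace then Rep_hsp (H.pact z (Abs_hsp F)) else hzero)"

lemma op_of_Rep: "op_of z (Rep_hsp v) = Rep_hsp (H.pact z v)"
  using Rep_hsp[of v] by (simp add: op_of_def Rep_hsp_inverse)

lemma op_of_in_Hspace: "op_of z F \<in> Hspace"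
  using Rep_hsp Hspace_zero by (simp add: op_of_def)

lemma hop_eqI:
  assumes "\<And>v. A (Rep_hsp v) = B (Rep_hsp v)" and "\<And>F. F \<notin> Hspace \<Longrightarrow> A F = B F"
  shows "A = (B :: hop)"
proof
  fix F
  show "A F = B F"
    using assms(1)[of "Abs_hsp F"] assms(2)[of F] by (cases "F \<in> Hspace") (auto simp: Abs_hsp_inverse)
qed

lemma op_of_outside: "F \<notin> Hspace \<Longrightarrow> op_of z F = hzero"
  by (simp add: op_of_def)

lemma op_of_add: "op_of (x + y) = op_add (op_of x) (op_of y)"
  by (rule hop_eqI)
    (simp_all add: op_add_def op_of_Rep op_of_outside H.pact_add plus_hsp.rep_eq, simp add: hadd_def hzero_def)

lemma op_of_cst_mult: "op_of (cst c * x) = op_smult c (op_of x)"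
  by (rule hop_eqI)
    (simp_all add: op_smult_def op_of_Rep op_of_outside H.pact_mult H.pact_cst hscale.rep_eq, simp add: hsmult_def hzero_def)

lemma op_of_hzero: "op_of x hzero = hzero"
  using op_of_Rep[of x 0] by (simp add: zero_hsp.rep_eq)

lemma op_of_mult: "op_of (x * y) = op_of x \<circ> op_of y"
  by (rule hop_eqI) (simp_all add: op_of_Rep op_of_outside H.pact_mult op_of_hzero)

lemma op_of_1: "op_of 1 = id_op"
  by (rule hop_eqI) (simp_all add: op_of_Rep op_of_outside id_op_def Rep_hsp)

lemma op_of_0: "op_of 0 = zero_op"
  by (rule hop_eqI) (simp_all add: op_of_Rep op_of_outside zero_op_def zero_hsp.rep_eq)

lemma op_of_cst: "op_of (cst c) = op_smult c id_op"
  using op_of_cst_mult[of c 1] by (simp add: op_of_1)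

lemma op_of_gX: "op_of gX = e4_op"
  by (rule hop_eqI) (simp_all add: op_of_Rep op_of_outside H.pact_gen e4_hsp.rep_eq, simp add: e4_op_def)

lemma op_of_gY: "op_of gY = e6_op"
  by (rule hop_eqI) (simp_all add: op_of_Rep op_of_outside H.pact_gen e6_hsp.rep_eq, simp add: e6_op_def)

lemma op_of_gD: "op_of gD = delta_op"
  by (rule hop_eqI) (simp_all add: op_of_Rep op_of_outside H.pact_gen delta_hsp.rep_eq, simp add: delta_op_def)

lemma range_op_of: "range op_of = Ralg"
proof
  show "range op_of \<subseteq> Ralg"
  proof clarify
    fix z show "op_of z \<in> Ralg"
    proof (induction z rule: palg_induct)
      case (cst c)
      show ?case unfolding op_of_cst by (intro Ralg.intros)
    next
      case (add x y)
      then show ?case unfolding op_of_add by (intro Ralg.intros)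
    next
      case (gen a x)
      have "op_of (gen a) \<in> Ralg" by (cases a) (auto simp: op_of_gX op_of_gY op_of_gD intro: Ralg.intros)
      then show ?case unfolding op_of_mult using gen by (intro Ralg.intros)
    qed
  qed
  show "Ralg \<subseteq> range op_of"
  proof
    fix A assume "A \<in> Ralg"
    then show "A \<in> range op_of"
    proof induction
      case (add A B)
      then show ?case by (auto simp: op_of_add[symmetric])
    next
      case (smult A c)
      then show ?case by (auto simp: op_of_cst_mult[symmetric])
    next
      case (comp A B)
      then obtain x y where "A = op_of x" "B = op_of y" by blast
      then have "A \<circ> B = op_of (x * y)" by (simp add: op_of_mult)
      then show ?case by blast
    qed (auto simp: op_of_gX[symmetric] op_of_gY[symmetric] op_of_gD[symmetric] op_of_1[symmetric])
  qed
qed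

section \<open>Vectors concentrated in one weight\<close>

definition hsingle :: "real \<Rightarrow> (complex \<Rightarrow> complex) \<Rightarrow> hvec" where
  "hsingle k f = (\<lambda>n z. if n = k \<and> z \<in> uhp then f z else 0)"

lemma hsingle_Hspace:
  assumes "f holomorphic_on uhp"
  shows "hsingle k f \<in> Hspace"
proof -
  have "hsingle k f n \<in> Hol" for n
  proof (cases "n = k")
    case True
    then have "hsingle k f n holomorphic_on uhp"
      using holomorphic_transform[OF assms, of "hsingle k f n"] by (simp add: hsingle_def)
    then show ?thesis by (simp add: Hol_def hsingle_def)
  qed (simp add: hsingle_def Hol_0)
  moreover have "finite {n. hsingle k f n \<noteq> (\<lambda>z. 0)}"
    by (rule finite_subset[of _ "{k}"]) (auto simp: hsingle_def)
  ultimately show ?thesis by (simp add: Hspace_def)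
qed

lemma e4_op_hsingle: "f holomorphic_on uhp \<Longrightarrow> e4_op (hsingle k f) = hsingle (k + 4) (\<lambda>z. E4 z * f z)"
  by (simp add: e4_op_def hsingle_Hspace) (auto simp: hsingle_def fun_eq_iff)

lemma e6_op_hsingle: "f holomorphic_on uhp \<Longrightarrow> e6_op (hsingle k f) = hsingle (k + 6) (\<lambda>z. E6 z * f z)"
  by (simp add: e6_op_def hsingle_Hspace) (auto simp: hsingle_def fun_eq_iff)

lemma op_of_gY_power_hsingle:
  "f holomorphic_on uhp \<Longrightarrow> op_of (gY ^ j) (hsingle k f) = hsingle (k + 6 * real j) (\<lambda>z. E6 z ^ j * f z)"
proof (induction j)
  case 0
  then show ?case by (simp add: op_of_1 id_op_def hsingle_Hspace)
next
  case (Suc j)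
  then have "(\<lambda>z. E6 z ^ j * f z) holomorphic_on uhp" by (intro holomorphic_intros E6_holomorphic)
  then show ?case using Suc by (simp add: op_of_mult op_of_gY e6_op_hsingle algebra_simps)
qed

lemma op_of_gX_power_hsingle:
  "f holomorphic_on uhp \<Longrightarrow> op_of (gX ^ i) (hsingle k f) = hsingle (k + 4 * real i) (\<lambda>z. E4 z ^ i * f z)"
proof (induction i)
  case 0
  then show ?case by (simp add: op_of_1 id_op_def hsingle_Hspace)
next
  case (Suc i)
  then have "(\<lambda>z. E4 z ^ i * f z) holomorphic_on uhp" by (intro holomorphic_intros E4_holomorphic)
  then show ?case using Suc by (simp add: op_of_mult op_of_gX e4_op_hsingle algebra_simps)
qed

lemma op_of_monomial_hsingle:
  assumes "f holomorphic_on uhp"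
  shows "op_of (cst c * (gX ^ i * gY ^ j)) (hsingle k f)
    = hsingle (k + (4 * real i + 6 * real j)) (\<lambda>z. c * E4 z ^ i * E6 z ^ j * f z)"
proof -
  have "(\<lambda>z. E6 z ^ j * f z) holomorphic_on uhp"
    using assms by (intro holomorphic_intros E6_holomorphic)
  then have "op_of (cst c * (gX ^ i * gY ^ j)) (hsingle k f)
      = hsmult c (hsingle (k + 6 * real j + 4 * real i) (\<lambda>z. E4 z ^ i * (E6 z ^ j * f z)))"
    using assms unfolding op_of_cst_mult by (simp add: op_smult_def op_of_mult op_of_gY_power_hsingle op_of_gX_power_hsingle)
  then show ?thesis by (auto simp: hsmult_def hsingle_def fun_eq_iff algebra_simps)
qed

lemma op_of_sum_apply: "finite F \<Longrightarrow> op_of (\<Sum>x\<in>F. g x) v n z = (\<Sum>x\<in>F. op_of (g x) v n z)"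
  by (induction F rule: finite_induct) (auto simp: op_of_0 zero_op_def hzero_def op_of_add op_add_def hadd_def)

text \<open>Each component of the result sees exactly the monomials of one weight: the grading
  separates the homogeneous parts.\<close>

lemma op_of_poly_hsingle:
  assumes "finite F" "f holomorphic_on uhp" "z \<in> uhp"
  shows "op_of (\<Sum>(i, j) \<in> F. cst (c i j) * (gX ^ i * gY ^ j)) (hsingle k f) n z
    = (\<Sum>(i, j) \<in> {(i, j) \<in> F. n = k + (4 * real i + 6 * real j)}. c i j * E4 z ^ i * E6 z ^ j) * f z"
proof -
  have "op_of (\<Sum>(i, j) \<in> F. cst (c i j) * (gX ^ i * gY ^ j)) (hsingle k f) n z
    = (\<Sum>(i, j) \<in> F. if n = k + (4 * real i + 6 * real j) then c i j * E4 z ^ i * E6 z ^ j * f z else 0)"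
    unfolding op_of_sum_apply[OF assms(1)] using assms
    by (intro sum.cong) (auto simp: op_of_monomial_hsingle, auto simp: hsingle_def)
  also have "\<dots> = (\<Sum>(i, j) \<in> {(i, j) \<in> F. n = k + (4 * real i + 6 * real j)}. c i j * E4 z ^ i * E6 z ^ j * f z)"
    using assms(1) by (intro sum.mono_neutral_cong_right) (auto split: if_splits)
  finally show ?thesis by (simp add: sum_distrib_right case_prod_unfold)
qed

text \<open>In each weight, division by \<open>f z\<close> leaves a relation between
  \<open>E4\<close> and \<open>E6\<close> at the points where \<open>Delta\<close> does not vanish.
  The condition on \<open>f\<close> is met by both \<open>1\<close> and
  \<open>Delta\<close>.\<close>

lemma pol_faithful:
  assumes "a \<in> pol" and f: "f holomorphic_on uhp" "\<And>z. z \<in> uhp \<Longrightarrow> Delta z \<noteq> 0 \<Longrightarrow> f z \<noteq> 0"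
    and zero: "op_of (gY ^ n * a) (hsingle k f) = hzero"
  shows "a = 0"
proof -
  obtain F c where F: "finite F" and a: "a = (\<Sum>(i, j) \<in> F. cst (c i j) * (gX ^ i * gY ^ j))"
    by (rule pol_eq_sum[OF \<open>a \<in> pol\<close>])
  \<comment> \<open>The factor \<open>gY ^ n\<close> shifts the second exponent by \<open>n\<close>;
    the coefficient \<open>c i (j - n)\<close> undoes the shift, and \<open>j \<ge> n\<close> holds
    throughout \<open>G\<close>.\<close>
  define G where "G = (\<lambda>(i, j). (i, n + j)) ` F"
  have G: "finite G" using F by (simp add: G_def)
  have Ya: "gY ^ n * a = (\<Sum>(i, j) \<in> G. cst (c i (j - n)) * (gX ^ i * gY ^ j))"
    unfolding a gY_power_mult_sum G_def by (subst sum.reindex) (auto simp: inj_on_def intro!: sum.cong)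
  have "c i0 j0 = 0" if "(i0, j0) \<in> F" for i0 j0
  proof -
    define w where "w = 4 * i0 + 6 * (n + j0)"
    have ij: "(i0, n + j0) \<in> {(i, j) \<in> G. k + real w = k + (4 * real i + 6 * real j)}"
      using that by (auto simp: w_def G_def)
    have "c i0 (n + j0 - n) = 0"
    proof (rule E4_E6_independent[of "{(i, j) \<in> G. k + real w = k + (4 * real i + 6 * real j)}" w "\<lambda>i j. c i (j - n)", OF _ _ _ ij])
      show "finite {(i, j) \<in> G. k + real w = k + (4 * real i + 6 * real j)}"
        by (rule finite_subset[OF _ G]) auto
      show "4 * i + 6 * j = w" if "(i, j) \<in> {(i, j) \<in> G. k + real w = k + (4 * real i + 6 * real j)}" for i j
      proof -
        have "real (4 * i + 6 * j) = real w" using that by simp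
        then show ?thesis by (simp only: of_nat_eq_iff)
      qed
      show "(\<Sum>(i, j) \<in> {(i, j) \<in> G. k + real w = k + (4 * real i + 6 * real j)}. c i (j - n) * E4 z ^ i * E6 z ^ j) = 0"
        if "z \<in> uhp" "Delta z \<noteq> 0" for z
        using op_of_poly_hsingle[OF G f(1) that(1), of "\<lambda>i j. c i (j - n)" k "k + real w"] zero f(2)[OF that]
        unfolding Ya by (simp add: hzero_def)
    qed
    then show ?thesis by simp
  qed
  then show ?thesis unfolding a by (intro sum.neutral) auto
qed

text \<open>The kernel is a two-sided ideal, and its elements \<open>gY ^ n * a\<close> are tested
  on the constant function \<open>1\<close> in weight 0.\<close>

lemma op_of_eq_zero_op: "op_of z = zero_op \<longleftrightarrow> z = 0"
proof
  assume "op_of z = zero_op"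
  then show "z = 0"
  proof (rule ideal_trivial[of "\<lambda>z. op_of z = zero_op", rotated -1])
    fix x y assume "op_of x = zero_op" "op_of y = zero_op"
    moreover have "x - y = x + cst (- 1) * y" by (simp add: cst_uminus)
    ultimately show "op_of (x - y) = zero_op"
      by (simp only: op_of_add op_of_cst_mult) (simp add: op_add_def op_smult_def zero_op_def hadd_def hsmult_def hzero_def)
  next
    fix w x assume "op_of x = zero_op"
    then show "op_of (w * x) = zero_op" "op_of (x * w) = zero_op"
      by (auto simp: op_of_mult zero_op_def op_of_hzero)
  next
    fix a n assume "a \<in> pol" "op_of (gY ^ n * a) = zero_op"
    then show "a = 0"
      using pol_faithful[of a "\<lambda>_. 1" n 0] by (simp add: zero_op_def)
  qed
qed (simp add: op_of_0)

lemma op_of_inj: "op_of x = op_of y \<Longrightarrow> x = y"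
proof -
  assume "op_of x = op_of y"
  moreover have "x - y = x + cst (- 1) * y" by (simp add: cst_uminus)
  ultimately have "op_of (x - y) = zero_op"
    by (simp only: op_of_add op_of_cst_mult) (simp add: op_add_def op_smult_def zero_op_def hadd_def hsmult_def hzero_def)
  then show "x = y" by (simp add: op_of_eq_zero_op)
qed

lemma quot_alg_iso_I3: "quot_alg_iso I3"
  unfolding quot_alg_iso_def
proof (intro exI[of _ "\<lambda>p. op_of (abs_palg p)"] conjI ballI allI)
  show "(\<lambda>p. op_of (abs_palg p)) ` ncT = Ralg"
  proof -
    have "op_of z \<in> (\<lambda>p. op_of (abs_palg p)) ` ncT" for z
      by (rule abs_palg_cases[of z]) auto
    then show ?thesis unfolding range_op_of[symmetric] by auto
  qed
  fix p q :: "gen3 ncp" assume p: "p \<in> ncT"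
  show "op_of (abs_palg (nc_smult c p)) = op_smult c (op_of (abs_palg p))" for c
    using p by (simp add: abs_palg_smult op_of_cst_mult)
  have "abs_palg p = 0 \<longleftrightarrow> p \<in> I3"
    using abs_palg_eq_iff[OF p ncT_zero] unfolding abs_palg_zero I3_eq
    by (simp add: nc_diff_def nc_zero_def)
  then show "op_of (abs_palg p) = zero_op \<longleftrightarrow> p \<in> I3" by (simp add: op_of_eq_zero_op)
  assume q: "q \<in> ncT"
  show "op_of (abs_palg (nc_add p q)) = op_add (op_of (abs_palg p)) (op_of (abs_palg q))"
    using p q by (simp add: abs_palg_add op_of_add)
  show "op_of (abs_palg (nc_mult p q)) = op_of (abs_palg p) \<circ> op_of (abs_palg q)"
    using p q by (simp add: abs_palg_mult op_of_mult)
qed (simp add: abs_palg_one op_of_1)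

lemma delta_op_hsingle:
  assumes f: "f holomorphic_on uhp" and zero: "\<And>z. z \<in> uhp \<Longrightarrow> deriv f z / (2 * of_real pi * \<i>) = of_real k / 12 * E2 z * f z"
  shows "delta_op (hsingle k f) = hzero"
proof (intro ext)
  fix m z
  have "Dk (m - 2) (hsingle k f (m - 2)) z = 0"
  proof (cases "m - 2 = k \<and> z \<in> uhp")
    case True
    have "deriv (hsingle k f k) z = deriv f z"
      by (rule deriv_cong_ev) (use True open_uhp in \<open>auto simp: hsingle_def eventually_nhds\<close>)
    then show ?thesis using True zero[of z] by (simp add: Dk_def) (simp add: hsingle_def)
  next
    case False
    then have "z \<notin> uhp \<or> hsingle k f (m - 2) = (\<lambda>z. 0)" by (auto simp: hsingle_def)
    then show ?thesis by (auto simp: Dk_def)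
  qed
  then show "delta_op (hsingle k f) m z = hzero m z"
    using hsingle_Hspace[OF f] by (simp add: delta_op_def hzero_def)
qed

section \<open>The modules generated by \<open>1\<close> and by \<open>Delta\<close>\<close>

definition vac :: hvec where "vac = hsingle 0 (\<lambda>_. 1)"

definition cusp :: hvec where "cusp = hsingle 12 Delta"

lemma delta_vac: "delta_op vac = hzero"
  unfolding vac_def by (rule delta_op_hsingle) auto

lemma delta_cusp: "delta_op cusp = hzero"
  unfolding cusp_def by (rule delta_op_hsingle) (auto simp: Delta_holomorphic deriv_Delta)

lemma op_of_plus_gD:
  assumes "delta_op v = hzero"
  shows "op_of (a + w * gD) v = op_of a v"
  using assms by (simp add: op_of_add op_add_def op_of_mult op_of_gD op_of_hzero) (simp add: hadd_def hzero_def)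

text \<open>Tensoring \<open>R\<close> with the line through \<open>v\<close> gives back
  \<open>R\<close>, with \<open>\<delta> \<otimes> v\<close> read as \<open>\<delta>\<close>; so one
  left ideal \<open>Rdelta\<close> serves both modules. The isomorphism is induced by evaluation at
  \<open>v\<close>, whose kernel is found by writing \<open>s\<close> as a polynomial plus a
  multiple of \<open>\<delta>\<close>.\<close>

lemma quot_mod_iso_Rdelta:
  assumes f: "f holomorphic_on uhp" "\<And>z. z \<in> uhp \<Longrightarrow> Delta z \<noteq> 0 \<Longrightarrow> f z \<noteq> 0"
    and v: "v = hsingle k f" "delta_op v = hzero" and image: "(\<lambda>z. op_of z v) ` pol = N"
  shows "quot_mod_iso Rdelta N"
  unfolding quot_mod_iso_def
proof (intro exI[of _ "\<lambda>s. s v"] conjI ballI allI)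
  show "(\<lambda>s. s v) ` Ralg = N"
  proof -
    have "op_of z v \<in> N" for z
      by (rule palg_eq_pol_plus_gD[of z]) (use image op_of_plus_gD[OF v(2)] in auto)
    then show ?thesis unfolding range_op_of[symmetric] using image by auto
  qed
  fix s assume "s \<in> Ralg"
  then obtain z where s: "s = op_of z" unfolding range_op_of[symmetric] by auto
  obtain a w where z: "a \<in> pol" "z = a + w * gD" by (rule palg_eq_pol_plus_gD)
  show "s v = hzero \<longleftrightarrow> s \<in> Rdelta"
  proof
    assume "s v = hzero"
    then have "op_of (gY ^ 0 * a) (hsingle k f) = hzero"
      using s z op_of_plus_gD[OF v(2)] v(1) by simp
    then have "a = 0" using pol_faithful[OF z(1) f] by blast
    then have "s = op_of w \<circ> delta_op" using s z by (simp add: op_of_mult op_of_gD)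
    then show "s \<in> Rdelta" unfolding Rdelta_def range_op_of[symmetric] by auto
  next
    assume "s \<in> Rdelta"
    then obtain w where "s = op_of w \<circ> delta_op" unfolding Rdelta_def range_op_of[symmetric] by auto
    then show "s v = hzero" using v(2) by (simp add: op_of_hzero)
  qed
qed (auto simp: op_add_def op_smult_def)

text \<open>A sum over an infinite index set would be 0 by convention; finiteness makes the sums in
  \<open>Mwt\<close> genuine.\<close>

lemma finite_weight: "finite {(a :: nat, b :: nat). 4 * real a + 6 * real b = n}"
proof (rule finite_subset)
  show "{(a :: nat, b :: nat). 4 * real a + 6 * real b = n} \<subseteq> {..nat \<lceil>n\<rceil>} \<times> {..nat \<lceil>n\<rceil>}"
  proof
    fix x :: "nat \<times> nat" assume "x \<in> {(a, b). 4 * real a + 6 * real b = n}"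
    then obtain a b where x: "x = (a, b)" "n = 4 * real a + 6 * real b" by auto
    then have "real a \<le> real (nat \<lceil>n\<rceil>)" "real b \<le> real (nat \<lceil>n\<rceil>)"
      using of_nat_ceiling[of n] by linarith+
    then show "x \<in> {..nat \<lceil>n\<rceil>} \<times> {..nat \<lceil>n\<rceil>}" using x(1) by simp
  qed
qed auto

lemma image_vac: "(\<lambda>z. op_of z vac) ` pol = Mset"
proof
  show "(\<lambda>z. op_of z vac) ` pol \<subseteq> Mset"
  proof clarify
    fix a assume "a \<in> pol"
    then obtain F c where F: "finite F" and a: "a = (\<Sum>(i, j) \<in> F. cst (c i j) * (gX ^ i * gY ^ j))"
      by (rule pol_eq_sum)
    have "op_of a vac n \<in> Mwt n" for n
    proof -
      \<comment> \<open>The sums in \<open>Mwt\<close> run over all exponents of weight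
        \<open>n\<close>, so the coefficients are extended by 0 beyond \<open>F\<close>.\<close>
      define d where "d i j = (if (i, j) \<in> F then c i j else 0)" for i j
      have "op_of a vac n = (\<lambda>z. if z \<in> uhp then
          (\<Sum>(i, j) \<in> {(i, j). 4 * real i + 6 * real j = n}. d i j * E4 z ^ i * E6 z ^ j) else 0)"
      proof
        fix z
        show "op_of a vac n z = (if z \<in> uhp then
          (\<Sum>(i, j) \<in> {(i, j). 4 * real i + 6 * real j = n}. d i j * E4 z ^ i * E6 z ^ j) else 0)"
        proof (cases "z \<in> uhp")
          case True
          have "op_of a vac n z = (\<Sum>(i, j) \<in> {(i, j) \<in> F. n = 0 + (4 * real i + 6 * real j)}. c i j * E4 z ^ i * E6 z ^ j)"
            unfolding a vac_def by (subst op_of_poly_hsingle[OF F _ True]) auto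
          also have "\<dots> = (\<Sum>(i, j) \<in> {(i, j). 4 * real i + 6 * real j = n}. d i j * E4 z ^ i * E6 z ^ j)"
            by (intro sum.mono_neutral_cong_left finite_weight) (auto simp: d_def split: if_splits)
          finally show ?thesis using True by simp
        qed (simp add: Hspace_outside[OF op_of_in_Hspace])
      qed
      then show ?thesis unfolding Mwt_def by blast
    qed
    then show "op_of a vac \<in> Mset" by (simp add: Mset_def op_of_in_Hspace)
  qed
  show "Mset \<subseteq> (\<lambda>z. op_of z vac) ` pol"
  proof
    fix G assume "G \<in> Mset"
    then have G: "G \<in> Hspace" "\<And>n. G n \<in> Mwt n" by (auto simp: Mset_def)
    define W where "W n = {(a :: nat, b :: nat). 4 * real a + 6 * real b = n}" for n
    have "\<exists>c. G n = (\<lambda>z. if z \<in> uhp then (\<Sum>(a, b) \<in> W n. c a b * E4 z ^ a * E6 z ^ b) else 0)" for n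
      using G(2)[of n] unfolding Mwt_def W_def by blast
    then have "\<exists>c. \<forall>n. G n = (\<lambda>z. if z \<in> uhp then (\<Sum>(a, b) \<in> W n. c n a b * E4 z ^ a * E6 z ^ b) else 0)"
      by (intro choice allI)
    then obtain c where c: "\<And>n. G n = (\<lambda>z. if z \<in> uhp then (\<Sum>(a, b) \<in> W n. c n a b * E4 z ^ a * E6 z ^ b) else 0)"
      by blast
    define S where "S = {n. G n \<noteq> (\<lambda>z. 0)}"
    have S: "finite S" using G(1) by (simp add: Hspace_def S_def)
    define F where "F = (\<Union>n\<in>S. W n)"
    have F: "finite F" using S finite_weight by (auto simp: F_def W_def)
    \<comment> \<open>A pair \<open>(i, j)\<close> occurs in one weight only, so the separately
      chosen coefficients of the components of \<open>G\<close> glue to a single family.\<close>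
    define d where "d i j = c (4 * real i + 6 * real j) i j" for i j
    define a where "a = (\<Sum>(i, j) \<in> F. cst (d i j) * (gX ^ i * gY ^ j))"
    have "a \<in> pol"
    proof -
      have "(\<Sum>x \<in> F. case x of (i, j) \<Rightarrow> cst (d i j) * (gX ^ i * gY ^ j)) \<in> pol"
        using F by induction (auto intro!: pol.add pol_cst_mult pol_mult pol_power)
      then show ?thesis by (simp add: a_def)
    qed
    moreover have "op_of a vac = G"
    proof (intro ext)
      fix n z
      show "op_of a vac n z = G n z"
      proof (cases "z \<in> uhp")
        case True
        have "op_of a vac n z = (\<Sum>(i, j) \<in> {(i, j) \<in> F. n = 0 + (4 * real i + 6 * real j)}. d i j * E4 z ^ i * E6 z ^ j)"
          unfolding a_def vac_def by (subst op_of_poly_hsingle[OF F _ True]) auto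
        also have "\<dots> = G n z"
        proof (cases "n \<in> S")
          case True
          then have "{(i, j) \<in> F. n = 0 + (4 * real i + 6 * real j)} = W n" by (auto simp: F_def W_def)
          moreover have "(\<Sum>(i, j) \<in> W n. d i j * E4 z ^ i * E6 z ^ j) = (\<Sum>(i, j) \<in> W n. c n i j * E4 z ^ i * E6 z ^ j)"
            by (rule sum.cong) (auto simp: W_def d_def)
          ultimately show ?thesis using \<open>z \<in> uhp\<close> by (simp add: c)
        next
          case False
          then have "{(i, j) \<in> F. n = 0 + (4 * real i + 6 * real j)} = {}" by (auto simp: F_def W_def)
          then have "(\<Sum>(i, j) \<in> {(i, j) \<in> F. n = 0 + (4 * real i + 6 * real j)}. d i j * E4 z ^ i * E6 z ^ j) = 0"
            by (simp only: sum.empty)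
          then show ?thesis using False by (simp add: S_def)
        qed
        finally show ?thesis .
      qed (simp add: Hspace_outside[OF op_of_in_Hspace] Hspace_outside[OF G(1)])
    qed
    ultimately show "G \<in> (\<lambda>z. op_of z vac) ` pol" by blast
  qed
qed

lemma quot_mod_iso_Mset: "quot_mod_iso Rdelta Mset"
  by (rule quot_mod_iso_Rdelta[OF _ _ vac_def delta_vac image_vac]) auto

text \<open>Polynomials act by multiplication, which commutes with the factor \<open>Delta\<close>;
  the shift is its weight 12.\<close>

lemma op_of_cusp:
  assumes "a \<in> pol"
  shows "op_of a cusp = (\<lambda>n z. Delta z * op_of a vac (n - 12) z)"
proof (intro ext)
  fix n z
  obtain F c where F: "finite F" and a: "a = (\<Sum>(i, j) \<in> F. cst (c i j) * (gX ^ i * gY ^ j))"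
    by (rule pol_eq_sum[OF assms])
  show "op_of a cusp n z = Delta z * op_of a vac (n - 12) z"
  proof (cases "z \<in> uhp")
    case True
    have "n = 12 + w \<longleftrightarrow> n - 12 = 0 + w" for w :: real by linarith
    then show ?thesis unfolding a vac_def cusp_def
      by (subst (1 2) op_of_poly_hsingle[OF F _ True]) (auto simp: Delta_holomorphic mult.commute)
  qed (simp add: Hspace_outside[OF op_of_in_Hspace])
qed

lemma quot_mod_iso_Sset: "quot_mod_iso Rdelta Sset"
proof (rule quot_mod_iso_Rdelta[OF Delta_holomorphic _ cusp_def delta_cusp])
  have "(\<lambda>a. op_of a cusp) ` pol = (\<lambda>G n z. Delta z * G (n - 12) z) ` (\<lambda>a. op_of a vac) ` pol"
    unfolding image_image by (rule image_cong) (auto simp: op_of_cusp)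
  then show "(\<lambda>a. op_of a cusp) ` pol = Sset"
    unfolding image_vac Sset_def by auto
qed

section \<open>The Weyl algebra\<close>


abbreviation "wX \<equiv> gen WX"
abbreviation "wY \<equiv> gen WY"
abbreviation "wDX \<equiv> gen WDX"
abbreviation "wDY \<equiv> gen WDY"

lemma
  shows wDX_wX: "wDX * wX = wX * wDX + 1" and wDY_wY: "wDY * wY = wY * wDY + 1"
    and wDX_wY: "wDX * wY = wY * wDX" and wDY_wX: "wDY * wX = wX * wDY"
    and wY_wX: "wY * wX = wX * wY"
proof -
  have "\<forall>p\<in>relators :: gen4 ncp set. abs_palg p = 0" using relator_zero by blast
  then show "wDX * wX = wX * wDX + 1" "wDY * wY = wY * wDY + 1"
    "wDX * wY = wY * wDX" "wDY * wX = wX * wDY" "wY * wX = wX * wY"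
    unfolding relators_gen4_def by (simp_all add: abs_palg_hom algebra_simps)
qed

text \<open>The image of \<open>d\<close> is the Serre derivative of \<open>\<complex>[E4, E6]\<close>, that is, the derivation with
  \<open>x \<mapsto> - y / 3\<close> and \<open>y \<mapsto> - x\<^sup>2 / 2\<close>.\<close>

fun weyl_image :: "gen3 \<Rightarrow> gen4 palg" where
  "weyl_image GX = wX"
| "weyl_image GY = wY"
| "weyl_image GD = cst (- 1 / 3) * (wY * wDX) + cst (- 1 / 2) * (wX * (wX * wDY))"

text \<open>Left multiplication by the images of the generators reduces the universal property to
  the construction of a module; the algebra homomorphism is recovered by acting on
  \<open>1\<close>.\<close>

interpretation S: word_rep "\<lambda>c v. cst c * v :: gen4 palg" "\<lambda>g v. weyl_image g * v"
proof
  show "weyl_image g * (cst c * v) = cst c * (weyl_image g * v)" for g c v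
    by (rule cst_left_commute)
qed (simp_all add: distrib_left distrib_right cst_add cst_mult mult.assoc del: weyl_image.simps)

lemma weyl_image_GD_GX: "weyl_image GD * wX = wX * weyl_image GD + cst (- 1 / 3) * wY"
proof -
  have "weyl_image GD * wX = cst (- 1 / 3) * (wY * (wDX * wX)) + cst (- 1 / 2) * (wX * (wX * (wDY * wX)))"
    by (simp add: distrib_right left_diff_distrib mult.assoc)
  also have "\<dots> = cst (- 1 / 3) * ((wY * wX) * wDX) + cst (- 1 / 2) * (wX * (wX * (wX * wDY))) + cst (- 1 / 3) * wY"
    unfolding wDX_wX wDY_wX by (simp add: distrib_left mult.assoc)
  also have "\<dots> = wX * weyl_image GD + cst (- 1 / 3) * wY"
    unfolding wY_wX by (simp add: distrib_left right_diff_distrib mult.assoc cst_left_commute)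
  finally show ?thesis .
qed

lemma weyl_image_GD_GY: "weyl_image GD * wY = wY * weyl_image GD + cst (- 1 / 2) * (wX * wX)"
proof -
  have "weyl_image GD * wY = cst (- 1 / 3) * (wY * (wDX * wY)) + cst (- 1 / 2) * (wX * (wX * (wDY * wY)))"
    by (simp add: distrib_right left_diff_distrib mult.assoc)
  also have "\<dots> = cst (- 1 / 3) * (wY * (wY * wDX)) + cst (- 1 / 2) * ((wX * (wX * wY)) * wDY) + cst (- 1 / 2) * (wX * wX)"
    unfolding wDX_wY wDY_wY by (simp add: distrib_left mult.assoc)
  also have "wX * (wX * wY) = wY * (wX * wX)"
    by (metis wY_wX mult.assoc)
  also have "cst (- 1 / 3) * (wY * (wY * wDX)) + cst (- 1 / 2) * ((wY * (wX * wX)) * wDY) + cst (- 1 / 2) * (wX * wX)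
      = wY * weyl_image GD + cst (- 1 / 2) * (wX * wX)"
    by (simp add: distrib_left right_diff_distrib mult.assoc cst_left_commute)
  finally show ?thesis .
qed

interpretation S: palg_rep "\<lambda>c v. cst c * v :: gen4 palg" "\<lambda>g v. weyl_image g * v"
proof
  fix g v assume "g \<in> (relators :: gen3 ncp set)"
  moreover have "wX * (wY * v) - wY * (wX * v) = 0"
    by (simp add: mult.assoc[symmetric] wY_wX)
  moreover have "weyl_image GD * (wX * v) - wX * (weyl_image GD * v) + cst (1 / 3) * (wY * v) = 0"
    unfolding mult.assoc[symmetric] weyl_image_GD_GX
    by (simp add: distrib_right left_diff_distrib mult.assoc cst_uminus del: weyl_image.simps(3))
  moreover have "weyl_image GD * (wY * v) - wY * (weyl_image GD * v) + cst (1 / 2) * (wX * (wX * v)) = 0"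
    unfolding mult.assoc[symmetric] weyl_image_GD_GY
    by (simp add: distrib_right left_diff_distrib mult.assoc cst_uminus del: weyl_image.simps(3))
  ultimately show "S.act g v = 0"
    by (auto simp: relators_gen3_def S.act_add S.act_comm S.act_mult S.act_smult S.act_var ncT_closed
        simp del: weyl_image.simps(3))
qed

definition weyl_hom :: "gen3 palg \<Rightarrow> gen4 palg" where "weyl_hom z = S.pact z 1"

lemma S_pact_eq: "S.pact z v = weyl_hom z * v"
  unfolding weyl_hom_def
  by (induction z rule: palg_induct)
    (simp_all add: S.pact_cst S.pact_add S.pact_mult S.pact_gen distrib_right mult.assoc del: weyl_image.simps)

lemma weyl_hom_add: "weyl_hom (x + y) = weyl_hom x + weyl_hom y"
  by (simp add: weyl_hom_def S.pact_add)

lemma weyl_hom_diff: "weyl_hom (x - y) = weyl_hom x - weyl_hom y"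
  by (simp add: weyl_hom_def S.pact_diff)

lemma weyl_hom_mult: "weyl_hom (x * y) = weyl_hom x * weyl_hom y"
  using S_pact_eq[of x "weyl_hom y"] by (simp add: weyl_hom_def S.pact_mult)

lemma weyl_hom_cst: "weyl_hom (cst c) = cst c"
  by (simp add: weyl_hom_def S.pact_cst)

lemma weyl_hom_1: "weyl_hom 1 = 1"
  by (simp add: weyl_hom_def)

lemma weyl_hom_gen: "weyl_hom (gen g) = weyl_image g"
  by (simp add: weyl_hom_def S.pact_gen)

lemma weyl_hom_power: "weyl_hom (x ^ n) = weyl_hom x ^ n"
  by (induction n) (simp_all add: weyl_hom_1 weyl_hom_mult)

lemma weyl_hom_sum: "weyl_hom (\<Sum>x\<in>F. g x) = (\<Sum>x\<in>F. weyl_hom (g x))"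
  by (simp add: weyl_hom_def S.pact_sum)

text \<open>The standard representation by differential operators on polynomials in \<open>y\<close>
  with coefficients in \<open>\<complex>[x]\<close>: \<open>map_poly pderiv\<close> differentiates
  in the inner variable \<open>x\<close>, \<open>pderiv\<close> in the outer variable
  \<open>y\<close>. It shows that the monomials in \<open>wX\<close>, \<open>wY\<close> stay
  independent in the Weyl algebra.\<close>

fun gen4_op :: "gen4 \<Rightarrow> complex poly poly \<Rightarrow> complex poly poly" where
  "gen4_op WX = smult [:0, 1:]"
| "gen4_op WY = pCons 0"
| "gen4_op WDX = map_poly pderiv"
| "gen4_op WDY = pderiv"

interpretation W: word_rep "\<lambda>c. smult [:c:] :: complex poly poly \<Rightarrow> _" gen4_op
proof
  show "smult [:a:] (x + y) = smult [:a:] x + smult [:a:] y" for a and x y :: "complex poly poly"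
    by (rule smult_add_right)
  show "smult [:a + b:] x = smult [:a:] x + smult [:b:] x" for a b and x :: "complex poly poly"
    by (simp add: smult_add_left[symmetric])
  show "smult [:a:] (smult [:b:] x) = smult [:a * b:] x" for a b and x :: "complex poly poly"
    by (simp add: mult.commute)
  show "smult [:1:] x = x" for x :: "complex poly poly"
    by (simp add: one_pCons[symmetric])
  show "gen4_op g (u + v) = gen4_op g u + gen4_op g v" for g u v
    by (cases g) (auto simp: smult_add_right pderiv_add intro!: poly_eqI simp: coeff_map_poly)
  show "gen4_op g (smult [:c:] v) = smult [:c:] (gen4_op g v)" for g c v
    by (cases g) (auto simp: pderiv_smult intro!: poly_eqI simp: coeff_map_poly coeff_pCons split: nat.split)
qed

interpretation W: palg_rep "\<lambda>c. smult [:c:] :: complex poly poly \<Rightarrow> _" gen4_op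
proof
  fix g and v :: "complex poly poly" assume g: "g \<in> (relators :: gen4 ncp set)"
  have 1: "map_poly pderiv (smult [:0, 1:] v) = smult [:0, 1:] (map_poly pderiv v) + v"
    by (rule poly_eqI) (simp add: coeff_map_poly pderiv_mult pderiv_pCons pderiv_add)
  have 2: "pderiv (pCons 0 v) = pCons 0 (pderiv v) + v"
    by (simp add: pderiv_pCons)
  have 3: "map_poly pderiv (pCons 0 v) = pCons 0 (map_poly pderiv v)"
    by (rule poly_eqI) (simp add: coeff_map_poly coeff_pCons split: nat.split)
  have 4: "pderiv (smult [:0, 1:] v) = smult [:0, 1:] (pderiv v)"
    by (rule pderiv_smult)
  have 5: "map_poly pderiv (pderiv v) = pderiv (map_poly pderiv v)"
  proof (rule poly_eqI)
    fix n
    have "pderiv (of_nat k * q) = of_nat k * pderiv q" for k and q :: "complex poly"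
      by (simp add: pderiv_mult)
    then show "coeff (map_poly pderiv (pderiv v)) n = coeff (pderiv (map_poly pderiv v)) n"
      by (simp only: coeff_map_poly coeff_pderiv pderiv_0)
  qed
  have 6: "smult [:0, 1:] (pCons 0 v) = pCons 0 (smult [:0, 1:] v)"
    by simp
  show "W.act g v = 0"
    using g 1 2 3 4 5 6
    by (auto simp: relators_gen4_def W.act_diff W.act_comm W.act_var W.act_one ncT_closed simp del: smult_pCons)
qed

lemma W_pact_monomial: "W.pact (cst c * (wX ^ i * wY ^ j)) 1 = monom (monom c i) j"
proof -
  have Y: "W.pact (wY ^ j) 1 = monom 1 j"
    by (induction j) (simp_all add: W.pact_mult W.pact_gen monom_Suc)
  have "W.pact (wX ^ i) v = smult (monom 1 i) v" for v
    by (induction i) (simp_all add: W.pact_mult W.pact_gen monom_Suc one_pCons[symmetric])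
  then show ?thesis
    using Y by (simp add: W.pact_mult W.pact_cst smult_monom)
qed

text \<open>Again the kernel is a two-sided ideal. A polynomial in \<open>wX\<close>,
  \<open>wY\<close> applied to \<open>1\<close> reproduces itself as an ordinary polynomial, where
  \<open>gY ^ n\<close> only shifts exponents and coefficients can be read off.\<close>

lemma weyl_hom_eq_0:
  assumes "weyl_hom z = 0"
  shows "z = 0"
  using assms
proof (rule ideal_trivial[of "\<lambda>z. weyl_hom z = 0", rotated -1])
  fix a n assume "a \<in> pol" and zero: "weyl_hom (gY ^ n * a) = 0"
  obtain F c where F: "finite F" and a: "a = (\<Sum>(i, j) \<in> F. cst (c i j) * (gX ^ i * gY ^ j))"
    by (rule pol_eq_sum[OF \<open>a \<in> pol\<close>])
  have "0 = W.pact (weyl_hom (gY ^ n * a)) 1" using zero by simp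
  also have "\<dots> = (\<Sum>(i, j) \<in> F. monom (monom (c i j) i) (n + j))"
    unfolding a gY_power_mult_sum weyl_hom_sum W.pact_sum
    by (rule sum.cong)
      (auto simp: weyl_hom_mult weyl_hom_cst weyl_hom_power weyl_hom_gen W_pact_monomial)
  finally have sum0: "(\<Sum>(i, j) \<in> F. monom (monom (c i j) i) (n + j)) = 0" ..
  have "c i0 j0 = 0" if "(i0, j0) \<in> F" for i0 j0
  proof -
    have "coeff (coeff (\<Sum>(i, j) \<in> F. monom (monom (c i j) i) (n + j)) (n + j0)) i0
        = (\<Sum>x \<in> F. if x = (i0, j0) then c i0 j0 else 0)"
      unfolding coeff_sum by (rule sum.cong) (auto simp: coeff_monom split: if_splits)
    then show ?thesis using sum0 F that by simp
  qed
  then show "a = 0" unfolding a by (intro sum.neutral) auto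
qed (simp_all add: weyl_hom_diff weyl_hom_mult)

lemma Ralg_embeds_into_Weyl: "alg_embeds_into_quot IWeyl"
proof -
  define rep where "rep y = (SOME p. p \<in> ncT \<and> abs_palg p = y)" for y :: "gen4 palg"
  have rep: "rep y \<in> ncT" "abs_palg (rep y) = y" for y
  proof -
    have "\<exists>p. p \<in> ncT \<and> abs_palg p = y" by (rule abs_palg_cases[of y]) auto
    then have "rep y \<in> ncT \<and> abs_palg (rep y) = y"
      unfolding rep_def by (rule someI_ex)
    then show "rep y \<in> ncT" "abs_palg (rep y) = y" by auto
  qed
  have IW: "nc_diff p q \<in> IWeyl \<longleftrightarrow> abs_palg p = abs_palg q" if "p \<in> ncT" "q \<in> ncT" for p q
    using abs_palg_eq_iff[OF that] by (simp add: IWeyl_eq)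
  define \<psi> where "\<psi> A = rep (weyl_hom (inv op_of A))" for A
  \<comment> \<open>Faithfulness of \<open>H\<close> lets an operator determine its element of
    \<open>T(V)/I\<close>, on which the homomorphism is defined.\<close>
  have inv: "inv op_of (op_of z) = z" for z
    by (rule inv_f_f) (auto intro: injI op_of_inj)
  have psi: "\<psi> (op_of z) \<in> ncT" "abs_palg (\<psi> (op_of z)) = weyl_hom z" for z
    by (auto simp: \<psi>_def inv rep)
  show ?thesis
    unfolding alg_embeds_into_quot_def range_op_of[symmetric]
  proof (intro exI[of _ \<psi>] conjI ballI allI impI; (elim rangeE)?; (hypsubst)?)
    show "\<psi> (op_of x) \<in> ncT" for x by (rule psi)
    show "nc_diff (\<psi> (op_add (op_of x) (op_of y))) (nc_add (\<psi> (op_of x)) (\<psi> (op_of y))) \<in> IWeyl" for x y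
      unfolding op_of_add[symmetric] by (simp add: IW psi ncT_closed abs_palg_add weyl_hom_add)
    show "nc_diff (\<psi> (op_smult c (op_of x))) (nc_smult c (\<psi> (op_of x))) \<in> IWeyl" for c x
      unfolding op_of_cst_mult[symmetric] by (simp add: IW psi ncT_closed abs_palg_smult weyl_hom_mult weyl_hom_cst)
    show "nc_diff (\<psi> (op_of x \<circ> op_of y)) (nc_mult (\<psi> (op_of x)) (\<psi> (op_of y))) \<in> IWeyl" for x y
      unfolding op_of_mult[symmetric] by (simp add: IW psi ncT_closed abs_palg_mult weyl_hom_mult)
    show "nc_diff (\<psi> id_op) nc_one \<in> IWeyl"
      unfolding op_of_1[symmetric] by (simp add: IW psi ncT_closed abs_palg_one weyl_hom_1)
    show "op_of x = zero_op" if "\<psi> (op_of x) \<in> IWeyl" for x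
    proof -
      have "nc_diff (\<psi> (op_of x)) nc_zero \<in> IWeyl" using that by (simp add: nc_diff_def nc_zero_def)
      then have "weyl_hom x = 0" by (simp add: IW psi ncT_closed abs_palg_zero)
      then have "x = 0" by (rule weyl_hom_eq_0)
      then show ?thesis by (simp add: op_of_0)
    qed
  qed
qed

theorem theorem3p5:
  shows "quot_alg_iso I3
       \<and> quot_mod_iso Rdelta Mset
       \<and> quot_mod_iso Rdelta Sset
       \<and> alg_embeds_into_quot IWeyl"
  using quot_alg_iso_I3 quot_mod_iso_Mset quot_mod_iso_Sset Ralg_embeds_into_Weyl by blast

end
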